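(* Let $\mathbf{k}$ be a field of characteristic zero and $B$ a $\mathbf{k}$-domain. If $\operatorname{trdeg}_{\mathbf{k}}(B)<\infty$ and $B$ is not semi-rigid then the following hold. (a) For each $D\in\operatorname{LND}(B)$, $\operatorname{Frac}(\ker D)$ is ruled over $\mathbf{k}$. (b) There exists a field $K$ satisfying $\mathbf{k}\subseteq K\subseteq\operatorname{Frac} B$ and $\operatorname{Frac} B=K^{(2)}$.
   Context: All rings are commutative with unity; "domain" means integral domain. A $\mathbf{k}$-domain is a domain that is a $\mathbf{k}$-algebra; $\operatorname{trdeg}_{\mathbf{k}}(B)$ is the transcendence degree of $\operatorname{Frac} B$ over $\mathbf{k}$. A derivation $D:B\to B$ is locally nilpotent if for each $x\in B$ there is $n\in\mathbb{N}$ with $D^n(x)=0$; $\operatorname{LND}(B)$ is the set of locally nilpotent derivations $B\to B$. A domain $B$ of characteristic zero is semi-rigid if the set $\{\ker D : D\in\operatorname{LND}(B)\setminus\{0\}\}$ has at most one element. For fields, $L=K^{(n)}$ means that $L$ is a purely transcendental extension of $K$ of transcendence degree $n$. A field extension $L/E$ is ruled ($L$ is ruled over $E$) if there is a field $F$ with $E\subseteq F\subseteq L$ and $L=F^{(1)}$. *)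

theory Defs
  imports
    Complex_Main
    "HOL-Library.Extended_Nat"
    "HOL-Library.Poly_Mapping"
    "HOL-Computational_Algebra.Polynomial_Factorial"
begin

section \<open>Subfields and transcendental extensions\<close>

text \<open>
  All fields occurring below are subfields of one ambient field, represented by a type of
  class \<open>field\<close>.
\<close>

definition is_subfield :: "'a::field set \<Rightarrow> bool" where
  "is_subfield K \<longleftrightarrow> 0 \<in> K \<and> 1 \<in> K \<and>
     (\<forall>x\<in>K. \<forall>y\<in>K. x + y \<in> K \<and> x * y \<in> K) \<and>
     (\<forall>x\<in>K. - x \<in> K \<and> inverse x \<in> K)"

definition adjoin :: "'a::field set \<Rightarrow> 'a set \<Rightarrow> 'a set" where
  "adjoin K S = \<Inter>{F. is_subfield F \<and> K \<subseteq> F \<and> S \<subseteq> F}"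

text \<open>
  A polynomial is a finitely supported function from monomials to coefficients, a monomial being
  a finitely supported function from variables to exponents. The variables are elements of the
  field themselves, and \<open>evaluate\<close> substitutes for each variable the element it is named after.
\<close>

definition evaluate :: "(('a \<Rightarrow>\<^sub>0 nat) \<Rightarrow>\<^sub>0 'a) \<Rightarrow> 'a::field" where
  "evaluate p = (\<Sum>m\<in>Poly_Mapping.keys p.
     poly_mapping.lookup p m * (\<Prod>x\<in>Poly_Mapping.keys m. x ^ poly_mapping.lookup m x))"

definition alg_indep :: "'a::field set \<Rightarrow> 'a set \<Rightarrow> bool" where
  "alg_indep K S \<longleftrightarrow>
     (\<forall>p. (\<forall>m\<in>Poly_Mapping.keys p. poly_mapping.lookup p m \<in> K \<and> Poly_Mapping.keys m \<subseteq> S) \<longrightarrow>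
          evaluate p = 0 \<longrightarrow> p = 0)"

text \<open>The transcendence degree of \<open>L\<close> over \<open>K\<close>, with all infinite values identified.\<close>

definition trdeg :: "'a::field set \<Rightarrow> 'a set \<Rightarrow> enat" where
  "trdeg K L = (SUP S \<in> {S. S \<subseteq> L \<and> finite S \<and> alg_indep K S}. enat (card S))"

text \<open>\<open>purely_transcendental K L n\<close> is the relation $L = K^{(n)}$.\<close>

definition purely_transcendental :: "'a::field set \<Rightarrow> 'a set \<Rightarrow> nat \<Rightarrow> bool" where
  "purely_transcendental K L n \<longleftrightarrow>
     (\<exists>S. finite S \<and> card S = n \<and> alg_indep K S \<and> L = adjoin K S)"

definition ruled :: "'a::field set \<Rightarrow> 'a set \<Rightarrow> bool" where
  "ruled E L \<longleftrightarrow>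
     (\<exists>F. is_subfield F \<and> E \<subseteq> F \<and> F \<subseteq> L \<and> purely_transcendental F L 1)"

section \<open>Locally nilpotent derivations\<close>

definition derivation :: "('b::comm_ring_1 \<Rightarrow> 'b) \<Rightarrow> bool" where
  "derivation D \<longleftrightarrow>
     (\<forall>x y. D (x + y) = D x + D y) \<and> (\<forall>x y. D (x * y) = D x * y + x * D y)"

definition LND :: "('b::comm_ring_1 \<Rightarrow> 'b) set" where
  "LND = {D. derivation D \<and> (\<forall>x. \<exists>n. (D ^^ n) x = 0)}"

definition ker :: "('b::comm_ring_1 \<Rightarrow> 'b) \<Rightarrow> 'b set" where
  "ker D = {x. D x = 0}"

definition semi_rigid :: "'b::idom itself \<Rightarrow> bool" where
  "semi_rigid _ \<longleftrightarrow>
     (\<forall>A \<in> ker ` (LND - {\<lambda>x::'b. 0}). \<forall>A' \<in> ker ` (LND - {\<lambda>x::'b. 0}). A = A')"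

section \<open>Algebras over a field and fields of fractions\<close>

text \<open>A \<open>k\<close>-algebra structure on \<open>B\<close> is given by its structure homomorphism.\<close>

definition algebra_map :: "('k::field \<Rightarrow> 'b::comm_ring_1) \<Rightarrow> bool" where
  "algebra_map \<iota> \<longleftrightarrow> \<iota> 1 = 1 \<and>
     (\<forall>x y. \<iota> (x + y) = \<iota> x + \<iota> y) \<and> (\<forall>x y. \<iota> (x * y) = \<iota> x * \<iota> y)"

text \<open>The image of the ground field in \<open>Frac B\<close>, with which it is identified.\<close>

definition ground_field :: "('k::field \<Rightarrow> 'b::idom) \<Rightarrow> 'b fract set" where
  "ground_field \<iota> = range (\<lambda>c. to_fract (\<iota> c))"

text \<open>The field of fractions of a subring \<open>A\<close> of \<open>B\<close>, as a subfield of \<open>Frac B\<close>.\<close>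

definition Frac :: "'b::idom set \<Rightarrow> 'b fract set" where
  "Frac A = {Fract a b | a b. a \<in> A \<and> b \<in> A \<and> b \<noteq> 0}"

end

theory Submission
  imports Defs "HOL-Computational_Algebra.Formal_Laurent_Series"
begin

text \<open>
  A nonzero locally nilpotent derivation \<open>D\<close> of \<open>B\<close> with kernel \<open>A\<close> makes \<open>Frac B\<close> the rational
  function field \<open>(Frac A)(r)\<close> in a local slice \<open>r\<close>. It also defines a discrete valuation on
  \<open>Frac B\<close>, minus the degree in \<open>r\<close>, which is trivial on \<open>Frac A\<close> and has residue field \<open>Frac A\<close>.

  If \<open>B\<close> is not semi-rigid, there are two such derivations \<open>D1\<close> and \<open>D2\<close> with distinct kernels.
  Write \<open>K1\<close> and \<open>K2\<close> for the fields of fractions of the kernels, and let \<open>s\<close> be a slice of \<open>D1\<close>.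
  The valuation of \<open>D2\<close> on the field \<open>Frac B = K1(s)\<close> has residue field \<open>K2\<close>. It is nontrivial on
  \<open>K1\<close>, because one kernel cannot contain the other (\<open>ker_subset_imp_eq\<close>). The ruled residue
  theorem (\<open>ruled_residue_field\<close>) then leaves two possibilities: \<open>K2\<close> is algebraic over the
  residue field \<open>k1\<close> of \<open>K1\<close>, or \<open>K2\<close> is a simple transcendental extension of a field that
  contains \<open>k1\<close> and hence the ground field. As the valuation is nontrivial on \<open>K1\<close>, the
  transcendence degree of \<open>k1\<close> over the ground field is smaller than that of \<open>K1\<close>, which is one
  less than that of \<open>Frac B\<close> and so equals that of \<open>K2\<close>. This excludes the first possibility
  (\<open>residue_extension_not_algebraic\<close>), and it is here that finiteness of the transcendence degree
  enters.

  So \<open>K2 = F(y)\<close> is ruled and \<open>Frac B = F(y)(t)\<close> for a slice \<open>t\<close> of \<open>D2\<close>. The kernel of an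
  arbitrary nonzero \<open>D\<close> differs from that of \<open>D1\<close> or of \<open>D2\<close>, so the same argument applies to it;
  the kernel of the zero derivation is \<open>B\<close>.

  The ruled residue theorem is proved for a discrete valuation by means of a key polynomial: a
  polynomial \<open>f\<close> of minimal degree whose value \<open>\<phi>\<close> at \<open>s\<close> contributes something transcendental
  over the residue field of \<open>K1\<close>. Polynomials of smaller degree contribute an algebraic extension
  \<open>k'\<close> of that residue field, and in the expansion of an arbitrary polynomial in powers of \<open>f\<close> no
  cancellation of leading terms can occur, as a power of \<open>\<phi>\<close> reduces to an element \<open>y\<close> that is
  transcendental over \<open>k'\<close>. The residue field is therefore \<open>k'(y)\<close>.
\<close>

section \<open>Subfields and polynomials over them\<close>

definition polys_over :: "'a::comm_ring_1 set \<Rightarrow> 'a poly set" where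
  "polys_over F = {p. \<forall>i. coeff p i \<in> F}"

context
  fixes F :: "'a::field set"
  assumes F: "is_subfield F"
begin

lemma subfield_0: "0 \<in> F" and subfield_1: "1 \<in> F"
  using F by (auto simp: is_subfield_def)

lemma subfield_add: "x \<in> F \<Longrightarrow> y \<in> F \<Longrightarrow> x + y \<in> F"
  and subfield_mult: "x \<in> F \<Longrightarrow> y \<in> F \<Longrightarrow> x * y \<in> F"
  and subfield_uminus: "x \<in> F \<Longrightarrow> - x \<in> F"
  and subfield_inverse: "x \<in> F \<Longrightarrow> inverse x \<in> F"
  using F by (auto simp: is_subfield_def)

lemma subfield_diff: "x \<in> F \<Longrightarrow> y \<in> F \<Longrightarrow> x - y \<in> F"
  using subfield_add[of x "- y"] subfield_uminus[of y] by simp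

lemma subfield_divide: "x \<in> F \<Longrightarrow> y \<in> F \<Longrightarrow> x / y \<in> F"
  using subfield_mult[of x "inverse y"] subfield_inverse[of y] by (simp add: divide_inverse)

lemma subfield_power: "x \<in> F \<Longrightarrow> x ^ n \<in> F"
  by (induction n) (auto intro: subfield_1 subfield_mult)

lemma subfield_power_int: "x \<in> F \<Longrightarrow> x powi n \<in> F"
  by (auto simp: power_int_def intro: subfield_power subfield_inverse)

lemma subfield_sum: "(\<And>i. i \<in> I \<Longrightarrow> f i \<in> F) \<Longrightarrow> sum f I \<in> F"
  by (induction I rule: infinite_finite_induct) (auto intro: subfield_0 subfield_add)

lemma subfield_prod: "(\<And>i. i \<in> I \<Longrightarrow> f i \<in> F) \<Longrightarrow> prod f I \<in> F"
  by (induction I rule: infinite_finite_induct) (auto intro: subfield_1 subfield_mult)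

lemmas subfield_intros = subfield_0 subfield_1 subfield_add subfield_mult subfield_uminus
  subfield_inverse subfield_diff subfield_divide subfield_power subfield_power_int
  subfield_sum subfield_prod

lemma polys_over_const: "c \<in> F \<Longrightarrow> [:c:] \<in> polys_over F"
  by (auto simp: polys_over_def coeff_pCons split: nat.split intro: subfield_0)

lemma polys_over_0: "0 \<in> polys_over F" and polys_over_1: "1 \<in> polys_over F"
  and polys_over_X: "[:0, 1:] \<in> polys_over F"
  by (auto simp: polys_over_def coeff_pCons split: nat.split intro: subfield_0 subfield_1)

lemma polys_over_add: "p \<in> polys_over F \<Longrightarrow> q \<in> polys_over F \<Longrightarrow> p + q \<in> polys_over F"
  and polys_over_diff: "p \<in> polys_over F \<Longrightarrow> q \<in> polys_over F \<Longrightarrow> p - q \<in> polys_over F"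
  and polys_over_uminus: "p \<in> polys_over F \<Longrightarrow> - p \<in> polys_over F"
  and polys_over_smult: "c \<in> F \<Longrightarrow> p \<in> polys_over F \<Longrightarrow> smult c p \<in> polys_over F"
  and polys_over_monom: "c \<in> F \<Longrightarrow> monom c n \<in> polys_over F"
  and polys_over_mult: "p \<in> polys_over F \<Longrightarrow> q \<in> polys_over F \<Longrightarrow> p * q \<in> polys_over F"
  and polys_over_pCons: "c \<in> F \<Longrightarrow> p \<in> polys_over F \<Longrightarrow> pCons c p \<in> polys_over F"
  by (auto simp: polys_over_def coeff_mult coeff_pCons split: nat.split intro!: subfield_intros)

lemmas polys_over_intros = polys_over_0 polys_over_1 polys_over_X polys_over_add polys_over_diff
  polys_over_uminus polys_over_smult polys_over_monom polys_over_mult polys_over_const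

lemma poly_in_subfield: "p \<in> polys_over F \<Longrightarrow> x \<in> F \<Longrightarrow> poly p x \<in> F"
  by (auto simp: poly_altdef polys_over_def intro!: subfield_intros)

lemma polys_over_division:
  assumes "g \<in> polys_over F" "f \<in> polys_over F" "degree f > 0"
  obtains q r where "q \<in> polys_over F" "r \<in> polys_over F" "g = q * f + r"
    "degree r < degree f" "q \<noteq> 0 \<Longrightarrow> degree g = degree q + degree f"
proof -
  have "\<exists>q r. q \<in> polys_over F \<and> r \<in> polys_over F \<and> g = q * f + r \<and> degree r < degree f"
    using assms(1)
  proof (induction "degree g" arbitrary: g rule: less_induct)
    case less
    show ?case
    proof (cases "degree g < degree f")
      case True
      then show ?thesis using less.prems
        by (intro exI[of _ 0] exI[of _ g]) (auto intro: polys_over_0)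
    next
      case False
      define m where "m = monom (lead_coeff g / lead_coeff f) (degree g - degree f)"
      have m: "m \<in> polys_over F" unfolding m_def using less.prems assms(2)
        by (intro polys_over_monom subfield_divide) (auto simp: polys_over_def)
      have f0: "f \<noteq> 0" and g0: "g \<noteq> 0" using assms(3) False by auto
      have "degree (g - m * f) < degree g"
      proof -
        have dm: "degree (m * f) = degree g"
          unfolding m_def using f0 g0 False by (subst degree_mult_eq) (auto simp: degree_monom_eq)
        have "lead_coeff (m * f) = lead_coeff g"
          unfolding lead_coeff_mult m_def using f0 g0 by (simp add: degree_monom_eq)
        then have "coeff (g - m * f) (degree g) = 0" using dm by simp
        moreover have "degree (g - m * f) \<le> degree g" using dm by (intro degree_diff_le) auto
        ultimately show ?thesis using assms(3) False
          by (metis degree_0 leading_coeff_0_iff nat_less_le not_gr_zero order.strict_trans2 linorder_not_le)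
      qed
      moreover have "g - m * f \<in> polys_over F"
        using less.prems m assms(2) by (intro polys_over_intros)
      ultimately obtain q r where "q \<in> polys_over F" "r \<in> polys_over F" "g - m * f = q * f + r"
        "degree r < degree f" using less.hyps by blast
      then show ?thesis using m
        by (intro exI[of _ "q + m"] exI[of _ r]) (auto intro: polys_over_add simp: algebra_simps)
    qed
  qed
  then obtain q r where qr: "q \<in> polys_over F" "r \<in> polys_over F" "g = q * f + r"
    "degree r < degree f" by blast
  have "degree g = degree q + degree f" if "q \<noteq> 0"
  proof -
    have "degree (q * f) = degree q + degree f" using that assms(3) by (intro degree_mult_eq) auto
    then show ?thesis using qr(3,4) by (simp add: degree_add_eq_left)
  qed
  then show ?thesis using that[OF qr] by blast
qed

end

lemma polys_over_pConsD: "pCons c p \<in> polys_over F \<Longrightarrow> c \<in> F \<and> p \<in> polys_over F"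
proof -
  assume "pCons c p \<in> polys_over F"
  then have "coeff (pCons c p) i \<in> F" for i unfolding polys_over_def by blast
  from this[of 0] this[of "Suc _"] show ?thesis by (simp add: polys_over_def)
qed

lemma polys_over_mono: "F \<subseteq> G \<Longrightarrow> polys_over F \<subseteq> polys_over G"
  by (auto simp: polys_over_def)

lemma is_subfield_adjoin: "is_subfield (adjoin K S)"
  unfolding is_subfield_def adjoin_def by blast

lemma adjoin_base: "K \<subseteq> adjoin K S" and adjoin_gen: "S \<subseteq> adjoin K S"
  by (auto simp: adjoin_def)

lemma adjoin_least: "is_subfield F \<Longrightarrow> K \<subseteq> F \<Longrightarrow> S \<subseteq> F \<Longrightarrow> adjoin K S \<subseteq> F"
  by (auto simp: adjoin_def)

lemma adjoin_mono: "K \<subseteq> K' \<Longrightarrow> S \<subseteq> S' \<Longrightarrow> adjoin K S \<subseteq> adjoin K' S'"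
  unfolding adjoin_def by blast

lemma adjoin_adjoin: "adjoin (adjoin K S) T = adjoin K (S \<union> T)"
proof (rule subset_antisym)
  show "adjoin (adjoin K S) T \<subseteq> adjoin K (S \<union> T)"
    using adjoin_gen[of "S \<union> T" K] by (intro adjoin_least is_subfield_adjoin adjoin_mono) auto
  show "adjoin K (S \<union> T) \<subseteq> adjoin (adjoin K S) T"
    using adjoin_base[of K S] adjoin_base[of "adjoin K S" T] adjoin_gen[of S K]
      adjoin_gen[of T "adjoin K S"]
    by (intro adjoin_least is_subfield_adjoin) auto
qed

lemma adjoin_insert: "adjoin K (insert x S) = adjoin (adjoin K S) {x}"
  by (simp add: adjoin_adjoin)

lemma adjoin_empty: "is_subfield K \<Longrightarrow> adjoin K {} = K"
  by (intro subset_antisym adjoin_least adjoin_base) auto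

lemma adjoin_singleton:
  assumes K: "is_subfield K"
  shows "adjoin K {x} =
    {poly p x / poly q x | p q. p \<in> polys_over K \<and> q \<in> polys_over K \<and> poly q x \<noteq> 0}" (is "_ = ?R")
proof (rule subset_antisym)
  have I: "poly p x / poly q x \<in> ?R" if "p \<in> polys_over K" "q \<in> polys_over K" "poly q x \<noteq> 0" for p q
    using that by blast
  have "is_subfield ?R"
    unfolding is_subfield_def
  proof (intro conjI ballI)
    show "0 \<in> ?R" "1 \<in> ?R" using I[of 0 1] I[of 1 1] K by (auto intro: polys_over_intros)
    fix a assume "a \<in> ?R"
    then obtain p q where a: "a = poly p x / poly q x" and p: "p \<in> polys_over K"
      and q: "q \<in> polys_over K" "poly q x \<noteq> 0" by blast
    show "- a \<in> ?R" using I[of "- p" q] p q a K by (simp add: polys_over_intros)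
    show "inverse a \<in> ?R" using I[of q p] I[of 0 1] p q a K
      by (cases "poly p x = 0") (simp_all add: polys_over_intros)
    fix b assume "b \<in> ?R"
    then obtain p' q' where b: "b = poly p' x / poly q' x" and p': "p' \<in> polys_over K"
      and q': "q' \<in> polys_over K" "poly q' x \<noteq> 0" by blast
    have "a + b = poly (p * q' + p' * q) x / poly (q * q') x" "a * b = poly (p * p') x / poly (q * q') x"
      using q q' by (simp_all add: a b add_frac_eq)
    then show "a + b \<in> ?R" "a * b \<in> ?R"
      using I[of "p * q' + p' * q" "q * q'"] I[of "p * p'" "q * q'"] p q p' q' K
      by (simp_all only: polys_over_intros poly_mult mult_eq_0_iff simp_thms)
  qed
  moreover have "K \<subseteq> ?R"
    using I[OF polys_over_const[OF K] polys_over_1[OF K]] by auto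
  moreover have "{x} \<subseteq> ?R"
    using I[OF polys_over_X[OF K] polys_over_1[OF K]] by auto
  ultimately show "adjoin K {x} \<subseteq> ?R" by (intro adjoin_least)
  have x: "x \<in> adjoin K {x}" using adjoin_gen by fast
  have "poly p x \<in> adjoin K {x}" if "p \<in> polys_over K" for p
    using poly_in_subfield[OF is_subfield_adjoin _ x] polys_over_mono[OF adjoin_base] that by blast
  then show "?R \<subseteq> adjoin K {x}"
    by (auto intro: subfield_divide[OF is_subfield_adjoin])
qed

text \<open>This turns a polynomial with coefficients in \<open>F(y)\<close> into one over \<open>F\<close> in two variables.\<close>

lemma adjoin_common_denominator:
  assumes F: "is_subfield F" and "finite C" "C \<subseteq> adjoin F {y}"
  shows "\<exists>d\<in>polys_over F. poly d y \<noteq> 0 \<and> (\<forall>c\<in>C. \<exists>a\<in>polys_over F. c * poly d y = poly a y)"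
  using assms(2,3)
proof (induction C rule: finite_induct)
  case empty
  then show ?case using polys_over_1[OF F] by (auto intro!: bexI[of _ 1])
next
  case (insert c C)
  then obtain d where d: "d \<in> polys_over F" "poly d y \<noteq> 0"
    "\<forall>c\<in>C. \<exists>a\<in>polys_over F. c * poly d y = poly a y" by auto
  from insert.prems obtain p q where c: "c = poly p y / poly q y" and p: "p \<in> polys_over F"
    and q: "q \<in> polys_over F" "poly q y \<noteq> 0" unfolding adjoin_singleton[OF F] by auto
  have "\<exists>a\<in>polys_over F. c' * poly (q * d) y = poly a y" if "c' \<in> insert c C" for c'
  proof (cases "c' = c")
    case True
    then show ?thesis using c q p d(1) F by (intro bexI[of _ "p * d"]) (auto intro: polys_over_intros)
  next
    case False
    then obtain a where a: "a \<in> polys_over F" "c' * poly d y = poly a y" using d(3) \<open>c' \<in> insert c C\<close> by auto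
    have "c' * poly (q * d) y = poly (q * a) y" using a(2) by (simp add: algebra_simps)
    then show ?thesis using polys_over_mult[OF F q(1) a(1)] by blast
  qed
  moreover have "q * d \<in> polys_over F" "poly (q * d) y \<noteq> 0"
    using q d polys_over_mult[OF F] by auto
  ultimately show ?case by blast
qed

section \<open>Independence for a closure operator with exchange\<close>

text \<open>
  Both linear span over a subfield and relative algebraic closure satisfy the exchange property,
  so one bound on the size of independent sets serves for dimension and for transcendence degree.
\<close>

locale pregeometry =
  fixes cl :: "'a set \<Rightarrow> 'a set"
  assumes cl_extensive: "S \<subseteq> cl S"
    and cl_least: "S \<subseteq> cl T \<Longrightarrow> cl S \<subseteq> cl T"
    and cl_exchange: "x \<in> cl (insert y S) \<Longrightarrow> x \<notin> cl S \<Longrightarrow> y \<in> cl (insert x S)"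
begin

definition indep :: "'a set \<Rightarrow> bool" where
  "indep S \<longleftrightarrow> (\<forall>x\<in>S. x \<notin> cl (S - {x}))"

lemma cl_mono: "S \<subseteq> T \<Longrightarrow> cl S \<subseteq> cl T"
  using cl_extensive[of T] by (intro cl_least) auto

lemma indep_empty: "indep {}"
  by (simp add: indep_def)

lemma indep_subset: "indep S \<Longrightarrow> T \<subseteq> S \<Longrightarrow> indep T"
  unfolding indep_def using cl_mono[of "T - {_}" "S - {_}"] by (meson Diff_mono subset_iff subset_refl)

lemma indep_insert:
  assumes "indep S" "x \<notin> cl S"
  shows "indep (insert x S)"
  unfolding indep_def
proof
  fix z assume z: "z \<in> insert x S"
  have xS: "x \<notin> S" using assms(2) cl_extensive[of S] by auto
  show "z \<notin> cl (insert x S - {z})"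
  proof (cases "z = x")
    case True
    then show ?thesis using assms(2) xS by simp
  next
    case False
    then have zS: "z \<in> S" using z by simp
    show ?thesis
    proof
      assume "z \<in> cl (insert x S - {z})"
      moreover have "insert x S - {z} = insert x (S - {z})" using False by auto
      moreover have "z \<notin> cl (S - {z})" using assms(1) zS by (auto simp: indep_def)
      ultimately have "x \<in> cl (insert z (S - {z}))" using cl_exchange by metis
      then show False using assms(2) zS by (simp add: insert_absorb)
    qed
  qed
qed

lemma indep_insertD: "indep (insert x S) \<Longrightarrow> x \<notin> S \<Longrightarrow> x \<notin> cl S"
  by (auto simp: indep_def)

text \<open>
  Steinitz exchange: an element of \<open>I\<close> outside \<open>W\<close> can be traded for an element of \<open>W\<close> that the
  remaining elements of \<open>I\<close> do not span, until \<open>I\<close> lies inside \<open>W\<close>.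
\<close>

lemma card_indep_le:
  assumes "finite I" "finite W" "indep I" "I \<subseteq> cl W"
  shows "card I \<le> card W"
  using assms
proof (induction "card (I - W)" arbitrary: I rule: less_induct)
  case less
  show ?case
  proof (cases "I \<subseteq> W")
    case True
    then show ?thesis using less.prems by (simp add: card_mono)
  next
    case False
    then obtain x where x: "x \<in> I" "x \<notin> W" by blast
    have "\<not> W \<subseteq> cl (I - {x})"
    proof
      assume "W \<subseteq> cl (I - {x})"
      then have "cl W \<subseteq> cl (I - {x})" by (rule cl_least)
      then show False using x less.prems by (auto simp: indep_def)
    qed
    then obtain w where w: "w \<in> W" "w \<notin> cl (I - {x})" by blast
    define I' where "I' = insert w (I - {x})"
    have wI: "w \<notin> I - {x}" using w cl_extensive[of "I - {x}"] by auto
    have "card I' = card I" unfolding I'_def using wI less.prems(1) x(1)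
      by (metis card.remove card_insert_disjoint finite_Diff)
    moreover have "indep I'" unfolding I'_def
      using indep_insert[OF indep_subset[OF less.prems(3)] w(2)] by auto
    moreover have "I' \<subseteq> cl W" using less.prems(4) w(1) cl_extensive[of W] unfolding I'_def by auto
    moreover have "I' - W \<subset> I - W" unfolding I'_def using x w by auto
    then have "card (I' - W) < card (I - W)" using less.prems(1) by (intro psubset_card_mono) auto
    moreover have "finite I'" using less.prems(1) by (simp add: I'_def)
    ultimately show ?thesis using less.hyps[of I'] less.prems(2) by simp
  qed
qed

end

section \<open>Relative algebraic closure\<close>

definition alg_closure :: "'a::field set \<Rightarrow> 'a set" where
  "alg_closure F = {x. \<exists>p\<in>polys_over F. p \<noteq> 0 \<and> poly p x = 0}"

text \<open>
  The linear span with scalars from the set \<open>F\<close>. Building it up by single terms gives each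
  property below a one-step induction, also for infinite \<open>S\<close>.
\<close>

inductive_set lspan :: "'a::field set \<Rightarrow> 'a set \<Rightarrow> 'a set" for F S where
  zero: "0 \<in> lspan F S"
| step: "c \<in> F \<Longrightarrow> w \<in> S \<Longrightarrow> u \<in> lspan F S \<Longrightarrow> c * w + u \<in> lspan F S"

lemma lspan_add: "x \<in> lspan F S \<Longrightarrow> y \<in> lspan F S \<Longrightarrow> x + y \<in> lspan F S"
  by (induction x rule: lspan.induct) (auto simp: add.assoc intro: lspan.intros)

context
  fixes F :: "'a::field set"
  assumes F: "is_subfield F"
begin

lemma lspan_scale: "x \<in> lspan F S \<Longrightarrow> c \<in> F \<Longrightarrow> c * x \<in> lspan F S"
proof (induction x rule: lspan.induct)
  case (step d w u)
  then have "(c * d) * w + c * u \<in> lspan F S" by (intro lspan.step) (auto intro: subfield_mult[OF F])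
  then show ?case by (simp add: algebra_simps)
qed (auto intro: lspan.zero)

lemma lspan_diff: "x \<in> lspan F S \<Longrightarrow> y \<in> lspan F S \<Longrightarrow> x - y \<in> lspan F S"
  using lspan_add[of x F S "- 1 * y"] lspan_scale[of y S "- 1"]
    subfield_uminus[OF F subfield_1[OF F]] by simp

lemma lspan_sum: "(\<And>i. i \<in> I \<Longrightarrow> f i \<in> lspan F S) \<Longrightarrow> sum f I \<in> lspan F S"
  by (induction I rule: infinite_finite_induct) (auto intro: lspan.zero lspan_add)

lemma lspan_gen: "w \<in> S \<Longrightarrow> w \<in> lspan F S"
  using lspan.step[of 1 F w S 0] lspan.zero subfield_1[OF F] by auto

lemma lspan_least: "S \<subseteq> lspan F T \<Longrightarrow> lspan F S \<subseteq> lspan F T"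
proof
  fix x assume S: "S \<subseteq> lspan F T" and "x \<in> lspan F S"
  from this(2) show "x \<in> lspan F T"
    by induction (use S in \<open>auto intro: lspan.zero lspan_add lspan_scale\<close>)
qed

lemma lspan_insertE:
  assumes "x \<in> lspan F (insert y S)"
  obtains c u where "c \<in> F" "u \<in> lspan F S" "x = c * y + u"
proof -
  from assms have "\<exists>c\<in>F. \<exists>u\<in>lspan F S. x = c * y + u"
  proof induction
    case zero
    then show ?case using lspan.zero subfield_0[OF F] by force
  next
    case (step d w v)
    then obtain c u where cu: "c \<in> F" "u \<in> lspan F S" "v = c * y + u" by blast
    show ?case
    proof (cases "w = y")
      case True
      then have "d * w + v = (d + c) * y + u" using cu by (simp add: algebra_simps)
      then show ?thesis using subfield_add[OF F] step cu by blast
    next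
      case False
      then have "d * w + u \<in> lspan F S" using step cu by (intro lspan.step) auto
      moreover have "d * w + v = c * y + (d * w + u)" using cu by simp
      ultimately show ?thesis using cu by blast
    qed
  qed
  then show ?thesis using that by blast
qed

lemma pregeometry_lspan: "pregeometry (lspan F)"
proof
  fix x y :: 'a and S :: "'a set"
  assume "x \<in> lspan F (insert y S)" and x: "x \<notin> lspan F S"
  then obtain c u where cu: "c \<in> F" "u \<in> lspan F S" "x = c * y + u" by (auto elim: lspan_insertE)
  then have c: "c \<noteq> 0" using x by auto
  have sub: "lspan F S \<subseteq> lspan F (insert x S)" by (rule lspan_least) (auto intro: lspan_gen)
  have "y = inverse c * (x - u)" using cu c by (simp add: field_simps)
  also have "\<dots> \<in> lspan F (insert x S)"
    using cu(1,2) sub lspan_gen[of x "insert x S"]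
    by (intro lspan_scale lspan_diff subfield_inverse[OF F]) auto
  finally show "y \<in> lspan F (insert x S)" .
qed (use lspan_gen lspan_least in blast)+

text \<open>
  Algebraic elements are handled through the subrings that are finite-dimensional as vector
  spaces; these absorb finitely many algebraic elements at once, which makes it unnecessary to
  exhibit annihilating polynomials of sums and products.
\<close>

definition finite_subalgebra :: "'a set \<Rightarrow> bool" where
  "finite_subalgebra E \<longleftrightarrow> (\<exists>W. finite W \<and> E = lspan F W) \<and> 1 \<in> E \<and> (\<forall>x\<in>E. \<forall>y\<in>E. x * y \<in> E)"

lemma finite_subalgebra_base: "finite_subalgebra E \<Longrightarrow> F \<subseteq> E"
  using lspan_scale[of 1] unfolding finite_subalgebra_def by fastforce

text \<open>
  If \<open>E\<close> is spanned by \<open>N\<close> elements, then among \<open>N + 1\<close> powers of \<open>x\<close> either two coincide or one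
  is a linear combination of the others.
\<close>

lemma finite_subalgebra_algebraic:
  assumes "finite_subalgebra E" "x \<in> E"
  shows "x \<in> alg_closure F"
proof -
  interpret pregeometry "lspan F" by (rule pregeometry_lspan)
  obtain W where W: "finite W" "E = lspan F W" using assms by (auto simp: finite_subalgebra_def)
  have pow: "x ^ i \<in> E" for i
    using assms by (induction i) (auto simp: finite_subalgebra_def)
  have rel: "\<exists>p\<in>polys_over F. coeff p i = 0 \<and> poly p x = u" if "u \<in> lspan F S"
    and S: "S \<subseteq> {x ^ j | j. j \<noteq> i}" for u S i
    using that(1)
  proof induction
    case zero
    then show ?case using polys_over_0[OF F] by (auto intro!: bexI[of _ 0])
  next
    case (step c w u)
    then obtain p where p: "p \<in> polys_over F" "coeff p i = 0" "poly p x = u" by blast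
    from step S obtain j where j: "w = x ^ j" "j \<noteq> i" by blast
    show ?case using p j step F
      by (intro bexI[of _ "monom c j + p"]) (auto simp: poly_monom intro: polys_over_intros)
  qed
  show ?thesis
  proof (cases "inj_on (\<lambda>i. x ^ i) {..card W}")
    case True
    define P where "P = (\<lambda>i. x ^ i) ` {..card W}"
    have "card P = Suc (card W)" using True by (simp add: P_def card_image)
    moreover have "P \<subseteq> lspan F W" using pow W by (auto simp: P_def)
    ultimately have "\<not> indep P" using card_indep_le[of P W] W by (auto simp: P_def)
    then obtain i where i: "x ^ i \<in> lspan F (P - {x ^ i})" by (auto simp: indep_def P_def)
    then obtain p where p: "p \<in> polys_over F" "coeff p i = 0" "poly p x = x ^ i"
      using rel[of "x ^ i" "P - {x ^ i}" i] unfolding P_def by auto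
    have "monom 1 i - p \<noteq> 0" using p(2) by (metis coeff_monom eq_iff_diff_eq_0 zero_neq_one)
    moreover have "monom 1 i - p \<in> polys_over F" using p F by (auto intro: polys_over_intros subfield_1)
    moreover have "poly (monom 1 i - p) x = 0" using p by (simp add: poly_monom)
    ultimately show ?thesis unfolding alg_closure_def by blast
  next
    case False
    then obtain i j where ij: "i \<noteq> j" "x ^ i = x ^ j" by (auto simp: inj_on_def)
    have "monom 1 i - monom 1 j \<noteq> (0 :: 'a poly)" using ij(1) by (simp add: monom_eq_iff')
    moreover have "monom 1 i - monom 1 j \<in> polys_over F" using F by (auto intro: polys_over_intros subfield_1)
    moreover have "poly (monom 1 i - monom 1 j) x = 0" using ij by (simp add: poly_monom)
    ultimately show ?thesis unfolding alg_closure_def by blast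
  qed
qed

text \<open>
  Adjoining to \<open>E\<close> a root \<open>x\<close> of a monic polynomial of degree \<open>n\<close> over \<open>E\<close> gives the span of the
  products \<open>w x^i\<close> with \<open>i < n\<close> and \<open>w\<close> a generator of \<open>E\<close>, since the polynomial rewrites \<open>x^n\<close> in
  lower powers.
\<close>

lemma finite_subalgebra_extend:
  assumes E: "finite_subalgebra E" and p: "p \<in> polys_over E" "lead_coeff p = 1" "poly p x = 0"
  shows "\<exists>E'. finite_subalgebra E' \<and> E \<subseteq> E' \<and> x \<in> E'"
proof -
  obtain W where W: "finite W" "E = lspan F W" using E by (auto simp: finite_subalgebra_def)
  define n where "n = degree p"
  have n: "n > 0"
  proof (rule ccontr)
    assume "\<not> n > 0"
    then have "degree p = 0" by (simp add: n_def)
    then obtain c where "p = [:c:]" by (rule degree_eq_zeroE)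
    then show False using p by simp
  qed
  define W' where "W' = (\<lambda>(w, i). w * x ^ i) ` (W \<times> {..<n})"
  define E' where "E' = lspan F W'"
  have E1: "1 \<in> E" and Emult: "\<And>a b. a \<in> E \<Longrightarrow> b \<in> E \<Longrightarrow> a * b \<in> E"
    using E by (auto simp: finite_subalgebra_def)
  have Ex: "e * x ^ i \<in> E'" if "e \<in> E" "i < n" for e i
    using that(1) unfolding W(2)
  proof induction
    case (step c w u)
    have "c * (w * x ^ i) + u * x ^ i \<in> E'" unfolding E'_def
      using step that(2) by (intro lspan.step) (auto simp: W'_def E'_def)
    then show ?case by (simp add: algebra_simps)
  qed (auto simp: E'_def intro: lspan.zero)
  \<comment> \<open>The elements that multiply \<open>E'\<close> into itself form a ring, and it contains the generators.\<close>
  define M where "M = {z. \<forall>u\<in>E'. z * u \<in> E'}"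
  have MI: "z \<in> M" if "\<And>w i. w \<in> W \<Longrightarrow> i < n \<Longrightarrow> z * (w * x ^ i) \<in> E'" for z
  proof -
    have "z * u \<in> E'" if "u \<in> lspan F W'" for u
      using that
    proof induction
      case (step c w u)
      then have "z * w \<in> E'" using \<open>\<And>w i. w \<in> W \<Longrightarrow> i < n \<Longrightarrow> z * (w * x ^ i) \<in> E'\<close>
        by (auto simp: W'_def)
      then have "c * (z * w) + z * u \<in> E'" using step lspan_scale lspan_add unfolding E'_def by blast
      then show ?case by (simp add: algebra_simps)
    qed (auto simp: E'_def intro: lspan.zero)
    then show ?thesis by (simp add: M_def E'_def)
  qed
  have WE: "w \<in> E" if "w \<in> W" for w using that W lspan_gen by auto
  have EM: "e \<in> M" if "e \<in> E" for e
    using Ex[OF Emult[OF that WE]] by (intro MI) (simp add: mult.assoc)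
  have Mmult: "a * b \<in> M" if "a \<in> M" "b \<in> M" for a b
    using that by (auto simp: M_def mult.assoc)
  have xM: "x \<in> M"
  proof (rule MI)
    fix w i assume w: "w \<in> W" and i: "i < n"
    show "x * (w * x ^ i) \<in> E'"
    proof (cases "Suc i < n")
      case True
      then show ?thesis using Ex[OF WE[OF w] True] by (simp add: algebra_simps)
    next
      case False
      then have Si: "Suc i = n" using i by simp
      have "0 = (\<Sum>j\<le>n. coeff p j * x ^ j)" using p(3) by (simp add: poly_altdef n_def)
      also have "\<dots> = (\<Sum>j<n. coeff p j * x ^ j) + x ^ n"
        using p(2) by (simp add: n_def flip: lessThan_Suc_atMost)
      finally have xn: "x ^ n = - (\<Sum>j<n. coeff p j * x ^ j)" by (simp add: eq_neg_iff_add_eq_0 add.commute)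
      have "x * (w * x ^ i) = w * x ^ n" using Si by (auto simp: algebra_simps)
      also have "\<dots> = 0 - (\<Sum>j<n. (w * coeff p j) * x ^ j)"
        by (simp add: xn sum_distrib_left mult.assoc)
      also have "\<dots> \<in> E'" unfolding E'_def
        using Emult[OF WE[OF w]] p(1) Ex
        by (intro lspan_diff lspan.zero lspan_sum) (auto simp: polys_over_def E'_def)
      finally show ?thesis .
    qed
  qed
  have E'1: "1 \<in> E'" using Ex[OF E1 n] by simp
  have "E' \<subseteq> M"
  proof
    fix u assume "u \<in> E'"
    then show "u \<in> M" unfolding E'_def
    proof induction
      case zero
      then show ?case by (auto simp: M_def E'_def intro: lspan.zero)
    next
      case (step c w u)
      then obtain w' i where "w = w' * x ^ i" "w' \<in> W" by (auto simp: W'_def)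
      moreover have "x ^ i \<in> M" for i
        using xM Mmult EM[OF E1] by (induction i) auto
      ultimately have "w \<in> M" using Mmult EM WE by auto
      then have "c * w \<in> M" using Mmult EM finite_subalgebra_base[OF E] step by blast
      then show ?case using step unfolding M_def E'_def by (auto simp: distrib_right intro: lspan_add)
    qed
  qed
  moreover have fW': "finite W'" using W(1) by (simp add: W'_def)
  ultimately have "finite_subalgebra E'"
    using E'1 fW' unfolding finite_subalgebra_def M_def E'_def[symmetric]
    by (intro conjI exI[of _ W'] ballI) (auto simp: E'_def)
  moreover have "E \<subseteq> E'" using Ex[OF _ n] by (metis mult.right_neutral power_0 subsetI)
  moreover have "x \<in> E'" using xM E'1 unfolding M_def by (metis (no_types, lifting) mem_Collect_eq mult.right_neutral)
  ultimately show ?thesis by blast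
qed

lemma alg_closureE_monic:
  assumes "is_subfield G" "x \<in> alg_closure G"
  obtains p where "p \<in> polys_over G" "lead_coeff p = 1" "poly p x = 0"
proof -
  obtain p where p: "p \<in> polys_over G" "p \<noteq> 0" "poly p x = 0"
    using assms(2) by (auto simp: alg_closure_def)
  have "smult (inverse (lead_coeff p)) p \<in> polys_over G"
    using p(1) assms(1) by (intro polys_over_smult subfield_inverse) (auto simp: polys_over_def)
  then show ?thesis using p by (intro that[of "smult (inverse (lead_coeff p)) p"]) auto
qed

lemma finite_subalgebra_absorbs:
  assumes "finite C" "C \<subseteq> alg_closure F"
  shows "\<exists>E. finite_subalgebra E \<and> C \<subseteq> E"
  using assms
proof (induction C rule: finite_induct)
  case empty
  have eq: "lspan F {1} = F"
  proof (rule subset_antisym)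
    show "lspan F {1} \<subseteq> F"
    proof
      fix x assume "x \<in> lspan F {1}"
      then show "x \<in> F" by induction (auto intro: subfield_intros[OF F])
    qed
    show "F \<subseteq> lspan F {1}" using lspan_scale[OF lspan_gen[of 1 "{1}"]] by auto
  qed
  have "finite_subalgebra F" unfolding finite_subalgebra_def
    using eq[symmetric] subfield_intros(2,4)[OF F] by blast
  then show ?case by auto
next
  case (insert c C)
  then obtain E where E: "finite_subalgebra E" "C \<subseteq> E" by auto
  obtain p where "p \<in> polys_over F" "lead_coeff p = 1" "poly p c = 0"
    using alg_closureE_monic[OF F] insert.prems by blast
  then show ?case
    using finite_subalgebra_extend[OF E(1), of p c] polys_over_mono[OF finite_subalgebra_base[OF E(1)]] E(2)
    by blast
qed

lemma alg_closure_base: "F \<subseteq> alg_closure F"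
proof
  fix x assume "x \<in> F"
  then have "[:- x, 1:] \<in> polys_over F" using F
    by (intro polys_over_pCons polys_over_0 subfield_1 subfield_uminus)
  then show "x \<in> alg_closure F" unfolding alg_closure_def by (auto intro!: bexI[of _ "[:- x, 1:]"])
qed

lemma is_subfield_alg_closure: "is_subfield (alg_closure F)"
  unfolding is_subfield_def
proof (intro conjI ballI)
  show "0 \<in> alg_closure F" "1 \<in> alg_closure F"
    using alg_closure_base subfield_0[OF F] subfield_1[OF F] by auto
  fix x assume x: "x \<in> alg_closure F"
  have "\<exists>E. finite_subalgebra E \<and> {x, y} \<subseteq> E" if "y \<in> alg_closure F" for y
    using x that by (intro finite_subalgebra_absorbs) auto
  note E = this
  have sub: "u - v \<in> E" "u + v \<in> E" "u * v \<in> E" "0 \<in> E"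
    if "finite_subalgebra E" "u \<in> E" "v \<in> E" for u v E
    using that lspan_diff lspan_add lspan.zero unfolding finite_subalgebra_def by blast+
  show "- x \<in> alg_closure F"
    using E[OF x] sub finite_subalgebra_algebraic by (metis diff_0 insert_subset)
  fix y assume y: "y \<in> alg_closure F"
  show "x + y \<in> alg_closure F" "x * y \<in> alg_closure F"
    using E[OF y] sub finite_subalgebra_algebraic by (meson insert_subset)+
next
  fix x assume x: "x \<in> alg_closure F"
  then obtain p where p: "p \<in> polys_over F" "p \<noteq> 0" "poly p x = 0" by (auto simp: alg_closure_def)
  show "inverse x \<in> alg_closure F"
  proof (cases "x = 0")
    case False
    have "poly (reflect_poly p) (inverse x) = 0"
      using False p by (subst poly_reflect_poly_nz) auto
    moreover have "reflect_poly p \<in> polys_over F"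
      using p(1) subfield_0[OF F] by (auto simp: polys_over_def coeff_reflect_poly)
    ultimately show ?thesis using p(2) unfolding alg_closure_def
      by (auto intro!: bexI[of _ "reflect_poly p"])
  qed (use x in auto)
qed

text \<open>
  The coefficients of a polynomial over the closure lie in one finite-dimensional subalgebra,
  which stays finite-dimensional when a root is adjoined.
\<close>

lemma alg_closure_idem: "alg_closure (alg_closure F) \<subseteq> alg_closure F"
proof
  fix x assume "x \<in> alg_closure (alg_closure F)"
  then obtain p where p: "p \<in> polys_over (alg_closure F)" "lead_coeff p = 1" "poly p x = 0"
    using alg_closureE_monic[OF is_subfield_alg_closure] by blast
  have "coeff p ` {..degree p} \<subseteq> alg_closure F" using p(1) by (auto simp: polys_over_def)
  then obtain E where E: "finite_subalgebra E" "coeff p ` {..degree p} \<subseteq> E"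
    using finite_subalgebra_absorbs by blast
  have "coeff p i \<in> E" for i
    using E subfield_0[OF F] finite_subalgebra_base[OF E(1)] by (cases "i \<le> degree p") (auto simp: coeff_eq_0)
  then have "p \<in> polys_over E" by (simp add: polys_over_def)
  then show "x \<in> alg_closure F"
    using finite_subalgebra_extend[OF E(1)] p finite_subalgebra_algebraic by blast
qed

lemma alg_closure_root: "x ^ n \<in> alg_closure F \<Longrightarrow> n > 0 \<Longrightarrow> x \<in> alg_closure F"
proof -
  assume x: "x ^ n \<in> alg_closure F" and n: "n > 0"
  define p where "p = monom 1 n - [:x ^ n:]"
  have "coeff p n = 1" using n by (simp add: p_def coeff_pCons split: nat.split)
  then have "p \<noteq> 0" by auto
  moreover have "p \<in> polys_over (alg_closure F)" unfolding p_def
    using x is_subfield_alg_closure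
    by (intro polys_over_diff polys_over_monom polys_over_const subfield_1)
  moreover have "poly p x = 0" by (simp add: p_def poly_monom)
  ultimately have "x \<in> alg_closure (alg_closure F)" unfolding alg_closure_def by blast
  then show ?thesis using alg_closure_idem by blast
qed

end

lemma alg_closure_mono: "F \<subseteq> G \<Longrightarrow> alg_closure F \<subseteq> alg_closure G"
  using polys_over_mono[of F G] by (auto simp: alg_closure_def)

lemma alg_closure_least:
  "is_subfield G \<Longrightarrow> F \<subseteq> alg_closure G \<Longrightarrow> alg_closure F \<subseteq> alg_closure G"
  using alg_closure_mono[of F "alg_closure G"] alg_closure_idem[of G] by blast

text \<open>
  A relation of \<open>x\<close> over \<open>F(y)\<close> becomes, after clearing denominators, a polynomial in two
  variables, and reading it as a polynomial in the other variable makes \<open>y\<close> algebraic over \<open>F(x)\<close>.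
\<close>

lemma alg_closure_exchange:
  assumes F: "is_subfield F" and x: "x \<in> alg_closure (adjoin F {y})" and nx: "x \<notin> alg_closure F"
  shows "y \<in> alg_closure (adjoin F {x})"
proof -
  obtain P where P: "P \<in> polys_over (adjoin F {y})" "P \<noteq> 0" "poly P x = 0"
    using x by (auto simp: alg_closure_def)
  define n where "n = degree P"
  have "coeff P ` {..n} \<subseteq> adjoin F {y}" using P(1) by (auto simp: polys_over_def)
  from adjoin_common_denominator[OF F _ this] obtain d where d: "d \<in> polys_over F" "poly d y \<noteq> 0"
    "\<forall>i\<le>n. \<exists>a\<in>polys_over F. coeff P i * poly d y = poly a y" by auto
  then obtain a where a: "\<And>i. i \<le> n \<Longrightarrow> a i \<in> polys_over F"
    "\<And>i. i \<le> n \<Longrightarrow> coeff P i * poly d y = poly (a i) y" by metis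
  define R where "R = (\<Sum>i\<le>n. smult (x ^ i) (a i))"
  have "poly R y = (\<Sum>i\<le>n. x ^ i * (coeff P i * poly d y))"
    by (simp add: R_def poly_sum a(2))
  also have "\<dots> = poly d y * poly P x"
    by (simp add: poly_altdef[of P] n_def sum_distrib_left mult_ac)
  finally have Ry: "poly R y = 0" using P by simp
  have R0: "R \<noteq> 0"
  proof
    assume R: "R = 0"
    have "a i = 0" if "i \<le> n" for i
    proof (rule poly_eqI)
      fix j
      define q where "q = (\<Sum>i\<le>n. monom (coeff (a i) j) i)"
      have "poly q x = coeff R j" by (simp add: q_def R_def poly_sum poly_monom coeff_sum mult.commute)
      moreover have "q \<in> polys_over F" unfolding polys_over_def q_def
        using a(1) by (auto simp: coeff_sum polys_over_def intro!: subfield_intros[OF F])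
      ultimately have "q = 0" using nx R by (auto simp: alg_closure_def)
      then have "coeff q i = 0" by simp
      moreover have "coeff q i = coeff (a i) j" using that by (simp add: q_def coeff_sum)
      ultimately show "coeff (a i) j = coeff 0 j" by simp
    qed
    then have "coeff P n * poly d y = 0" using a(2)[of n] by simp
    then show False using d P by (simp add: n_def)
  qed
  have sub: "F \<subseteq> adjoin F {x}" and xin: "x \<in> adjoin F {x}" using adjoin_base[of F "{x}"] adjoin_gen[of "{x}" F] by auto
  have "coeff R j \<in> adjoin F {x}" for j
    unfolding R_def coeff_sum coeff_smult using a(1) sub xin is_subfield_adjoin
    by (intro subfield_sum subfield_mult subfield_power) (auto simp: polys_over_def)
  then have "R \<in> polys_over (adjoin F {x})" by (simp add: polys_over_def)
  then show ?thesis using R0 Ry by (auto simp: alg_closure_def)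
qed

lemma pregeometry_alg_closure: "pregeometry (\<lambda>S. alg_closure (adjoin k S))"
proof
  have base: "adjoin k T \<subseteq> alg_closure (adjoin k T)" for T
    by (rule alg_closure_base[OF is_subfield_adjoin])
  show "S \<subseteq> alg_closure (adjoin k S)" for S
    using adjoin_gen[of S k] base[of S] by (rule order_trans)
  show "alg_closure (adjoin k S) \<subseteq> alg_closure (adjoin k T)"
    if "S \<subseteq> alg_closure (adjoin k T)" for S T
    using that order_trans[OF adjoin_base[of k T] base]
    by (intro alg_closure_least adjoin_least is_subfield_alg_closure is_subfield_adjoin)
  show "y \<in> alg_closure (adjoin k (insert x S))"
    if "x \<in> alg_closure (adjoin k (insert y S))" "x \<notin> alg_closure (adjoin k S)" for x y S
    using that alg_closure_exchange[OF is_subfield_adjoin, of x k S y]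
    unfolding adjoin_insert[of k _ S] by blast
qed

section \<open>Algebraic independence and transcendence bases\<close>

lemma alg_indep_empty: "alg_indep K {}"
  unfolding alg_indep_def
proof (intro allI impI)
  fix p :: "('a \<Rightarrow>\<^sub>0 nat) \<Rightarrow>\<^sub>0 'a"
  assume "\<forall>m\<in>Poly_Mapping.keys p. Poly_Mapping.lookup p m \<in> K \<and> Poly_Mapping.keys m \<subseteq> {}"
  then have sub: "Poly_Mapping.keys p \<subseteq> {0}" by auto
  assume e: "evaluate p = 0"
  show "p = 0"
  proof (rule ccontr)
    assume "p \<noteq> 0"
    then have "Poly_Mapping.keys p = {0}" using sub by (auto simp: subset_singleton_iff)
    then have "Poly_Mapping.lookup p 0 \<noteq> 0" "evaluate p = Poly_Mapping.lookup p 0"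
      by (auto simp: evaluate_def in_keys_iff)
    then show False using e by simp
  qed
qed

text \<open>
  A polynomial relation in \<open>x\<close> and the elements of \<open>S\<close> is a polynomial relation in \<open>x\<close> alone, its
  coefficients being the values at \<open>S\<close> of the polynomials that collect the terms of equal degree
  in \<open>x\<close>.
\<close>

lemma alg_indep_insert:
  assumes ind: "alg_indep K S" and x: "x \<notin> alg_closure (adjoin K S)"
  shows "alg_indep K (insert x S)"
  unfolding alg_indep_def
proof (intro allI impI)
  let ?F = "adjoin K S"
  have F: "is_subfield ?F" by (rule is_subfield_adjoin)
  fix p :: "('a \<Rightarrow>\<^sub>0 nat) \<Rightarrow>\<^sub>0 'a"
  assume p: "\<forall>m\<in>Poly_Mapping.keys p. Poly_Mapping.lookup p m \<in> K \<and> Poly_Mapping.keys m \<subseteq> insert x S"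
  assume e: "evaluate p = 0"
  let ?X = "\<lambda>j. Poly_Mapping.single x j"
  \<comment> \<open>The coefficient of \<open>x^j\<close> in \<open>p\<close>, with \<open>x\<close> removed from its monomials.\<close>
  define q where "q j = Abs_poly_mapping
      (\<lambda>m. Poly_Mapping.lookup p (m + ?X j) when Poly_Mapping.lookup m x = 0)" for j
  have inj: "inj (\<lambda>m. m + ?X j)" for j :: nat
    by (rule injI) simp
  have fin: "finite {m. (Poly_Mapping.lookup p (m + ?X j) when Poly_Mapping.lookup m x = 0) \<noteq> 0}" for j
  proof (rule finite_subset)
    show "{m. (Poly_Mapping.lookup p (m + ?X j) when Poly_Mapping.lookup m x = 0) \<noteq> 0}
      \<subseteq> (\<lambda>m. m + ?X j) -` Poly_Mapping.keys p"
      by (auto simp: when_def in_keys_iff split: if_splits)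
    show "finite ((\<lambda>m. m + ?X j) -` Poly_Mapping.keys p)"
      by (intro finite_vimageI inj) simp
  qed
  have lq: "Poly_Mapping.lookup (q j) m =
      (if Poly_Mapping.lookup m x = 0 then Poly_Mapping.lookup p (m + ?X j) else 0)" for j m
    unfolding q_def by (subst lookup_Abs_poly_mapping[OF fin]) (simp add: when_def)
  have kq: "Poly_Mapping.keys (q j) =
      {m. Poly_Mapping.lookup m x = 0 \<and> m + ?X j \<in> Poly_Mapping.keys p}" for j
    by (auto simp: in_keys_iff lq simp del: lookup_not_eq_zero_eq_in_keys split: if_splits)
  have qcond: "Poly_Mapping.lookup (q j) m \<in> K \<and> Poly_Mapping.keys m \<subseteq> S"
    if "m \<in> Poly_Mapping.keys (q j)" for j m
  proof -
    have m: "Poly_Mapping.lookup m x = 0" "m + ?X j \<in> Poly_Mapping.keys p" using that kq by auto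
    have "y \<in> S" if "y \<in> Poly_Mapping.keys m" for y
    proof -
      have "y \<noteq> x" using that m(1) by (auto simp: in_keys_iff)
      moreover have "y \<in> Poly_Mapping.keys (m + ?X j)" using that by (simp add: in_keys_iff lookup_add)
      ultimately show ?thesis using p m(2) by blast
    qed
    then show ?thesis using p m lq by auto
  qed
  have qF: "evaluate (q j) \<in> ?F" for j
    unfolding evaluate_def
    using qcond adjoin_base[of K S] adjoin_gen[of S K] F
    by (intro subfield_sum[OF F] subfield_mult[OF F] subfield_prod[OF F] subfield_power[OF F]) blast+
  define J where "J = (\<lambda>m. Poly_Mapping.lookup m x) ` Poly_Mapping.keys p"
  have fJ: "finite J" by (simp add: J_def)
  define mon where "mon m = (\<Prod>y\<in>Poly_Mapping.keys m. y ^ Poly_Mapping.lookup m y)" for m :: "'a \<Rightarrow>\<^sub>0 nat"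
  have mon: "mon (m + ?X j) = mon m * x ^ j" if "Poly_Mapping.lookup m x = 0" for m j
  proof -
    have xm: "x \<notin> Poly_Mapping.keys m" using that by (simp add: in_keys_iff)
    have "Poly_Mapping.keys (m + ?X j) \<subseteq> insert x (Poly_Mapping.keys m)"
      by (auto simp: in_keys_iff lookup_add lookup_single when_def split: if_splits)
    then have "mon (m + ?X j) = (\<Prod>y\<in>insert x (Poly_Mapping.keys m). y ^ Poly_Mapping.lookup (m + ?X j) y)"
      unfolding mon_def by (rule prod.mono_neutral_left[rotated]) (auto simp: in_keys_iff)
    also have "\<dots> = x ^ j * (\<Prod>y\<in>Poly_Mapping.keys m. y ^ Poly_Mapping.lookup (m + ?X j) y)"
      using xm that by (simp add: lookup_add)
    also have "(\<Prod>y\<in>Poly_Mapping.keys m. y ^ Poly_Mapping.lookup (m + ?X j) y) = mon m"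
      unfolding mon_def using xm
      by (intro prod.cong) (auto simp: lookup_add lookup_single when_def)
    finally show ?thesis by (simp add: mult.commute)
  qed
  have ev: "evaluate (q j) * x ^ j
      = (\<Sum>m\<in>{m\<in>Poly_Mapping.keys p. Poly_Mapping.lookup m x = j}. Poly_Mapping.lookup p m * mon m)" for j
  proof -
    have "evaluate (q j) * x ^ j = (\<Sum>m\<in>Poly_Mapping.keys (q j).
        Poly_Mapping.lookup p (m + ?X j) * mon (m + ?X j))"
      unfolding evaluate_def mon_def[symmetric] sum_distrib_right
      by (intro sum.cong) (auto simp: kq lq mon)
    also have "\<dots> = (\<Sum>m\<in>(\<lambda>m. m + ?X j) ` Poly_Mapping.keys (q j). Poly_Mapping.lookup p m * mon m)"
      by (subst sum.reindex) (auto intro: inj_on_subset[OF inj])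
    also have "(\<lambda>m. m + ?X j) ` Poly_Mapping.keys (q j)
        = {m\<in>Poly_Mapping.keys p. Poly_Mapping.lookup m x = j}"
    proof (intro subset_antisym subsetI)
      fix m assume m: "m \<in> {m\<in>Poly_Mapping.keys p. Poly_Mapping.lookup m x = j}"
      define m' where "m' = m - ?X j"
      have "m = m' + ?X j" "Poly_Mapping.lookup m' x = 0" using m
        by (auto simp: m'_def lookup_add lookup_minus lookup_single when_def intro!: poly_mapping_eqI)
      then show "m \<in> (\<lambda>m. m + ?X j) ` Poly_Mapping.keys (q j)" using m kq by auto
    qed (auto simp: kq lookup_add)
    finally show ?thesis .
  qed
  define Q where "Q = (\<Sum>j\<in>J. monom (evaluate (q j)) j)"
  have cQ: "coeff Q j = (if j \<in> J then evaluate (q j) else 0)" for j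
    using fJ by (simp add: Q_def coeff_sum)
  have "poly Q x = (\<Sum>j\<in>J. evaluate (q j) * x ^ j)"
    by (simp add: Q_def poly_sum poly_monom)
  also have "\<dots> = evaluate p"
    unfolding ev unfolding evaluate_def mon_def[symmetric] J_def
    by (rule sum.image_gen[symmetric]) simp
  finally have "poly Q x = 0" using e by simp
  moreover have "Q \<in> polys_over ?F"
    using qF subfield_0[OF F] by (simp add: polys_over_def cQ)
  ultimately have Q0: "Q = 0" using x by (auto simp: alg_closure_def)
  have q0: "q j = 0" if "j \<in> J" for j
  proof -
    have "evaluate (q j) = 0" using cQ[of j] Q0 that by simp
    then show ?thesis using ind qcond unfolding alg_indep_def by blast
  qed
  show "p = 0"
  proof (rule ccontr)
    assume "p \<noteq> 0"
    then have "Poly_Mapping.keys p \<noteq> {}" by simp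
    then obtain m where m: "m \<in> Poly_Mapping.keys p" by blast
    define j where "j = Poly_Mapping.lookup m x"
    define m' where "m' = m - ?X j"
    have "m = m' + ?X j" "Poly_Mapping.lookup m' x = 0"
      by (auto simp: m'_def j_def lookup_add lookup_minus lookup_single when_def intro!: poly_mapping_eqI)
    then have "m' \<in> Poly_Mapping.keys (q j)" using m kq by auto
    then show False using q0[of j] m by (auto simp: J_def j_def)
  qed
qed

lemma purely_transcendental_1I:
  assumes K: "is_subfield K" and "y \<notin> alg_closure K" "L = adjoin K {y}"
  shows "purely_transcendental K L 1"
  unfolding purely_transcendental_def
  using assms alg_indep_insert[OF alg_indep_empty, of y K] by (intro exI[of _ "{y}"]) (simp add: adjoin_empty)

lemma purely_transcendental_2I:
  assumes K: "is_subfield K" and y: "y \<notin> alg_closure K" and t: "t \<notin> alg_closure (adjoin K {y})"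
    and L: "L = adjoin (adjoin K {y}) {t}"
  shows "purely_transcendental K L 2"
proof -
  have "y \<in> alg_closure (adjoin K {y})"
    using adjoin_gen[of "{y}" K] alg_closure_base[OF is_subfield_adjoin, of K "{y}"] by auto
  then have "t \<noteq> y" using t by blast
  then have "card {t, y} = 2" by simp
  moreover have "alg_indep K {t, y}"
    using y t K by (intro alg_indep_insert alg_indep_empty) (simp_all add: adjoin_empty)
  moreover have "L = adjoin K {t, y}" using L by (simp add: adjoin_insert[of K t])
  ultimately show ?thesis unfolding purely_transcendental_def by (intro exI[of _ "{t, y}"]) simp
qed

text \<open>
  Independent sets for the algebraic closure operator are algebraically independent in the sense
  of polynomials, so the transcendence degree bounds their size and one of those inside \<open>E\<close> is
  maximal.
\<close>

lemma exists_transcendence_basis: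
  assumes "trdeg k UNIV < \<infinity>"
  obtains I where "finite I" "I \<subseteq> E" "pregeometry.indep (\<lambda>S. alg_closure (adjoin k S)) I"
    "E \<subseteq> alg_closure (adjoin k I)"
proof -
  interpret pregeometry "\<lambda>S. alg_closure (adjoin k S)" by (rule pregeometry_alg_closure)
  obtain N where N: "trdeg k UNIV = enat N" using assms by (cases "trdeg k UNIV") auto
  have ai: "alg_indep k S" if "finite S" "indep S" for S
    using that
  proof (induction S rule: finite_induct)
    case (insert x S)
    then show ?case
      using indep_subset[OF insert.prems, of S] indep_insertD[OF insert.prems]
      by (intro alg_indep_insert) auto
  qed (simp add: alg_indep_empty)
  have card: "card S \<le> N" if "finite S" "indep S" for S
  proof -
    have "enat (card S) \<le> trdeg k UNIV" unfolding trdeg_def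
      using that ai by (intro SUP_upper) auto
    then show ?thesis using N by simp
  qed
  define P where "P n \<longleftrightarrow> (\<exists>I. finite I \<and> I \<subseteq> E \<and> indep I \<and> card I = n)" for n
  have "P 0" unfolding P_def using indep_empty by (intro exI[of _ "{}"]) auto
  moreover have "\<And>n. P n \<Longrightarrow> n \<le> N" using card by (auto simp: P_def)
  ultimately obtain n where n: "P n" "\<And>n'. P n' \<Longrightarrow> n' \<le> n"
    using GreatestI_ex_nat[of P N] Greatest_le_nat[of P _ N] by blast
  then obtain I where I: "finite I" "I \<subseteq> E" "indep I" "card I = n" by (auto simp: P_def)
  have "E \<subseteq> alg_closure (adjoin k I)"
  proof (rule ccontr)
    assume "\<not> ?thesis"
    then obtain x where x: "x \<in> E" "x \<notin> alg_closure (adjoin k I)" by blast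
    then have "x \<notin> I" using cl_extensive[of I] by auto
    then have "P (Suc n)" unfolding P_def
      using I x indep_insert[OF I(3) x(2)] by (intro exI[of _ "insert x I"]) auto
    then show False using n(2) by fastforce
  qed
  then show ?thesis using that I by blast
qed

section \<open>Discrete valuations and the ruled residue theorem\<close>

text \<open>
  A discrete valuation is encoded by an embedding \<open>V\<close> of the field into formal Laurent series:
  \<open>ord\<close> is the valuation, and \<open>lc\<close> is multiplicative and restricts to the residue map on the
  elements of order zero.
\<close>

locale laurent_embedding =
  fixes V :: "'a::field \<Rightarrow> 'c::field fls"
  assumes V_1: "V 1 = 1"
    and V_add: "V (x + y) = V x + V y"
    and V_mult: "V (x * y) = V x * V y"
begin

definition ord :: "'a \<Rightarrow> int" where "ord x = fls_subdegree (V x)"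

definition lc :: "'a \<Rightarrow> 'c" where "lc x = fls_nth (V x) (ord x)"

lemma V_0: "V 0 = 0"
  using V_add[of 0 0] by (metis add_0_right add_cancel_right_right)

lemma V_eq_0_iff: "V x = 0 \<longleftrightarrow> x = 0"
proof
  assume "V x = 0"
  then show "x = 0" using V_mult[of x "inverse x"] V_1 by (cases "x = 0") auto
qed (simp add: V_0)

lemma lc_0 [simp]: "lc 0 = 0" and ord_0 [simp]: "ord 0 = 0"
  by (simp_all add: lc_def ord_def V_0)

lemma lc_eq_0_iff [simp]: "lc x = 0 \<longleftrightarrow> x = 0"
  unfolding lc_def ord_def nth_fls_subdegree_zero_iff V_eq_0_iff ..

lemma ord_mult: "x \<noteq> 0 \<Longrightarrow> y \<noteq> 0 \<Longrightarrow> ord (x * y) = ord x + ord y"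
  by (simp add: ord_def V_mult V_eq_0_iff)

lemma lc_mult: "lc (x * y) = lc x * lc y"
  by (cases "x = 0 \<or> y = 0") (auto simp: lc_def ord_def V_mult V_eq_0_iff V_0)

lemma ord_1 [simp]: "ord 1 = 0" and lc_1 [simp]: "lc 1 = 1"
  by (simp_all add: lc_def ord_def V_1)

lemma lc_inverse: "lc (inverse x) = inverse (lc x)"
  using lc_mult[of x "inverse x"] by (cases "x = 0") (auto simp: field_simps)

lemma ord_inverse: "ord (inverse x) = - ord x"
  using ord_mult[of x "inverse x"] by (cases "x = 0") auto

lemma ord_power: "ord (x ^ n) = int n * ord x"
  by (cases "x = 0"; induction n) (auto simp: ord_mult algebra_simps)

lemma lc_power: "lc (x ^ n) = lc x ^ n"
  by (induction n) (auto simp: lc_mult)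

lemma lc_divide: "lc (x / y) = lc x / lc y"
  by (simp add: divide_inverse lc_mult lc_inverse)

lemma ord_divide: "x \<noteq> 0 \<Longrightarrow> y \<noteq> 0 \<Longrightarrow> ord (x / y) = ord x - ord y"
  by (simp add: divide_inverse ord_mult ord_inverse)

lemma lc_power_int: "lc (x powi n) = lc x powi n"
  by (simp add: power_int_def lc_power lc_inverse)

lemma ord_power_int: "ord (x powi n) = n * ord x"
  by (simp add: power_int_def ord_power ord_inverse)

lemma ord_minus: "ord (- x) = ord x" and lc_minus: "lc (- x) = - lc x"
proof -
  have "V (- x) = - V x" using V_add[of x "- x"] V_0 by (simp add: eq_neg_iff_add_eq_0 add.commute)
  then show "ord (- x) = ord x" "lc (- x) = - lc x" by (simp_all add: ord_def lc_def)
qed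

lemma add_dominant:
  assumes "x \<noteq> 0" "y = 0 \<or> ord x < ord y"
  shows "x + y \<noteq> 0 \<and> ord (x + y) = ord x \<and> lc (x + y) = lc x"
proof (cases "y = 0")
  case False
  have V0: "fls_nth (V x) (ord x) \<noteq> 0" using assms(1) by (simp add: ord_def V_eq_0_iff)
  have n: "fls_nth (V (x + y)) (ord x) = fls_nth (V x) (ord x)"
    using assms False by (simp add: V_add ord_def)
  have "ord (x + y) = ord x" unfolding ord_def[of "x + y"]
    using n V0 assms False by (intro fls_subdegree_eqI) (auto simp: V_add ord_def)
  then show ?thesis using n V0 by (auto simp: lc_def V_0)
qed (use assms in auto)

lemma add_nondegenerate:
  assumes "x \<noteq> 0" "y \<noteq> 0" "ord x = ord y" "lc x + lc y \<noteq> 0"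
  shows "x + y \<noteq> 0 \<and> ord (x + y) = ord x \<and> lc (x + y) = lc x + lc y"
proof -
  have n: "fls_nth (V (x + y)) (ord x) = lc x + lc y"
    using assms by (simp add: V_add lc_def)
  have "ord (x + y) = ord x" unfolding ord_def[of "x + y"]
    using n assms by (intro fls_subdegree_eqI) (auto simp: V_add ord_def)
  then show ?thesis using n assms(4) by (auto simp: lc_def V_0)
qed

definition residues :: "'a set \<Rightarrow> 'c set" where
  "residues K = insert 0 {lc x | x. x \<in> K \<and> x \<noteq> 0 \<and> ord x = 0}"

lemma residuesI: "x \<in> K \<Longrightarrow> ord x = 0 \<Longrightarrow> lc x \<in> residues K"
  by (cases "x = 0") (auto simp: residues_def)

lemma residuesE:
  assumes "is_subfield K" "u \<in> residues K"
  obtains x where "x \<in> K" "ord x = 0" "u = lc x"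
  using assms(2) that[OF subfield_0[OF assms(1)]] by (auto simp: residues_def intro: that)

lemma is_subfield_residues:
  assumes K: "is_subfield K"
  shows "is_subfield (residues K)"
  unfolding is_subfield_def
proof (intro conjI ballI)
  show "0 \<in> residues K" by (simp add: residues_def)
  show "1 \<in> residues K" using residuesI[of 1 K] subfield_1[OF K] by simp
  fix u assume "u \<in> residues K"
  then obtain x where x: "x \<in> K" "ord x = 0" "u = lc x"
    using residuesE[OF K] by blast
  show "- u \<in> residues K" using residuesI[of "- x" K] x subfield_uminus[OF K]
    by (simp add: ord_minus lc_minus)
  show "inverse u \<in> residues K" using residuesI[of "inverse x" K] x subfield_inverse[OF K]
    by (simp add: ord_inverse lc_inverse)
  fix v assume "v \<in> residues K"
  then obtain y where y: "y \<in> K" "ord y = 0" "v = lc y"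
    using residuesE[OF K] by blast
  show "u * v \<in> residues K" using residuesI[of "x * y" K] x y subfield_mult[OF K]
    by (cases "x = 0 \<or> y = 0") (auto simp: ord_mult lc_mult residues_def)
  show "u + v \<in> residues K"
  proof (cases "x = 0 \<or> y = 0 \<or> lc x + lc y = 0")
    case True
    then show ?thesis using x y residuesI[of x K] residuesI[of y K] by (auto simp: residues_def)
  next
    case False
    then have "ord (x + y) = 0" "lc (x + y) = u + v" using add_nondegenerate[of x y] x y by auto
    then show ?thesis using residuesI[of "x + y" K] x y subfield_add[OF K] by auto
  qed
qed

end

text \<open>
  The valuation is nontrivial on \<open>K\<close>, as witnessed by \<open>a\<close>. This makes the value group of \<open>K\<close> of
  finite index in that of \<open>K(s)\<close>.
\<close>

locale valued_simple_extension = laurent_embedding V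
  for V :: "'a::field \<Rightarrow> 'c::field fls" +
  fixes K :: "'a set" and a s :: 'a
  assumes K: "is_subfield K" and a: "a \<in> K" "ord a > 0"
begin

abbreviation "A \<equiv> alg_closure (residues K)"

lemma A: "is_subfield A" and A_root: "x ^ n \<in> A \<Longrightarrow> n > 0 \<Longrightarrow> x \<in> A"
  and A_base: "residues K \<subseteq> A" and A_idem: "alg_closure A \<subseteq> A"
  using is_subfield_residues[OF K]
  by (simp_all add: is_subfield_alg_closure alg_closure_base alg_closure_idem alg_closure_root)

lemma a0: "a \<noteq> 0" using a by auto

abbreviation m :: nat where "m \<equiv> nat (ord a)"

lemma m: "m > 0" "int m = ord a"
  using a by auto

text \<open>
  The \<open>m\<close>-th power of an element \<open>x\<close> can be moved to order zero by a power of \<open>a\<close>; for \<open>i = ord x\<close>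
  and \<open>c = lc x\<close> this is the residue that results.
\<close>

definition norm_res :: "int \<Rightarrow> 'c \<Rightarrow> 'c" where
  "norm_res i c = c ^ m * lc a powi (- i)"

lemma norm_res_mult: "norm_res (i + j) (c * d) = norm_res i c * norm_res j d"
  using a0 power_int_add[of "lc a" "- i" "- j"] by (simp add: norm_res_def power_mult_distrib mult_ac)

lemma norm_res_0: "norm_res 0 c = c ^ m"
  by (simp add: norm_res_def)

lemma norm_res_eq_0_iff: "norm_res i c = 0 \<longleftrightarrow> c = 0"
  using a0 m by (simp add: norm_res_def)

lemma norm_res_inverse: "norm_res (- i) (inverse c) = inverse (norm_res i c)"
  by (simp add: norm_res_def power_int_minus power_inverse)

lemma norm_res_diff: "norm_res (i - j) (c / d) = norm_res i c / norm_res j d"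
  using norm_res_mult[of i "- j" c "inverse d"] by (simp add: norm_res_inverse divide_inverse)

lemma norm_res_power: "norm_res (int n * i) (c ^ n) = norm_res i c ^ n"
  by (induction n) (auto simp: norm_res_0 norm_res_mult distrib_right)

text \<open>
  The nonzero elements with this property form a multiplicative group, and two of them of equal
  order have a quotient whose residue is algebraic over the residue field of \<open>K\<close>.
\<close>

definition algebraic_ord_lc :: "'a \<Rightarrow> bool" where
  "algebraic_ord_lc x \<longleftrightarrow> norm_res (ord x) (lc x) \<in> A"

lemma algebraic_cong: "ord x = ord y \<Longrightarrow> lc x = lc y \<Longrightarrow> algebraic_ord_lc x \<longleftrightarrow> algebraic_ord_lc y"
  by (simp add: algebraic_ord_lc_def)

lemma algebraic_mult: "x \<noteq> 0 \<Longrightarrow> y \<noteq> 0 \<Longrightarrow> algebraic_ord_lc x \<Longrightarrow> algebraic_ord_lc y \<Longrightarrow> algebraic_ord_lc (x * y)"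
  by (simp add: algebraic_ord_lc_def ord_mult lc_mult norm_res_mult subfield_mult[OF A])

lemma algebraic_multD:
  assumes "x \<noteq> 0" "y \<noteq> 0" "algebraic_ord_lc x" "algebraic_ord_lc (x * y)"
  shows "algebraic_ord_lc y"
proof -
  have "norm_res (ord y) (lc y) = norm_res (ord (x * y)) (lc (x * y)) / norm_res (ord x) (lc x)"
    using assms by (simp add: ord_mult lc_mult norm_res_mult norm_res_eq_0_iff)
  then show ?thesis using assms(3,4) subfield_divide[OF A] by (simp add: algebraic_ord_lc_def)
qed

lemma algebraic_base: "x \<in> K \<Longrightarrow> algebraic_ord_lc x"
proof (cases "x = 0")
  case True
  then have "norm_res (ord x) (lc x) = 0" by (simp only: norm_res_eq_0_iff lc_0)
  then show ?thesis by (simp add: algebraic_ord_lc_def subfield_0[OF A])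
next
  case False
  assume x: "x \<in> K"
  let ?z = "x ^ m * a powi (- ord x)"
  have "ord ?z = 0" using False a0 m by (simp add: ord_mult ord_power ord_power_int)
  moreover have "?z \<in> K" using x a by (intro subfield_mult[OF K] subfield_power[OF K] subfield_power_int[OF K])
  ultimately have "lc ?z \<in> A" using residuesI A_base by blast
  then show ?thesis by (simp add: algebraic_ord_lc_def norm_res_def lc_mult lc_power lc_power_int)
qed

lemma algebraic_quotient:
  assumes "ord x = ord y" "x \<noteq> 0" "y \<noteq> 0" "algebraic_ord_lc y"
  shows "algebraic_ord_lc x \<longleftrightarrow> lc x / lc y \<in> A"
proof -
  have *: "(lc x / lc y) ^ m = norm_res (ord x) (lc x) / norm_res (ord y) (lc y)"
    using assms norm_res_diff[of "ord x" "ord y" "lc x" "lc y"] by (simp add: norm_res_0)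
  show ?thesis
  proof
    assume "algebraic_ord_lc x"
    then show "lc x / lc y \<in> A"
      using assms(4) * m A_root subfield_divide[OF A] unfolding algebraic_ord_lc_def by metis
  next
    assume "lc x / lc y \<in> A"
    then have "(lc x / lc y) ^ m * norm_res (ord y) (lc y) \<in> A"
      using assms(4) unfolding algebraic_ord_lc_def by (intro subfield_mult[OF A] subfield_power[OF A])
    then show "algebraic_ord_lc x"
      unfolding * using assms by (simp add: algebraic_ord_lc_def norm_res_eq_0_iff)
  qed
qed

end

text \<open>
  A key polynomial: of minimal degree among the polynomials whose value at \<open>s\<close> contributes a
  transcendental element to the residue field.
\<close>

locale key_polynomial = valued_simple_extension V K a s
  for V :: "'a::field \<Rightarrow> 'c::field fls" and K a s +
  fixes f :: "'a poly"
  assumes f: "f \<in> polys_over K" and f_trans: "\<not> algebraic_ord_lc (poly f s)"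
    and f_minimal: "\<And>g. g \<in> polys_over K \<Longrightarrow> degree g < degree f \<Longrightarrow> algebraic_ord_lc (poly g s)"
begin

abbreviation \<phi> :: 'a where "\<phi> \<equiv> poly f s"

lemma \<phi>0: "\<phi> \<noteq> 0"
  using f_trans algebraic_base[OF subfield_0[OF K]] by metis

lemma degree_f: "degree f > 0"
proof (rule ccontr)
  assume "\<not> degree f > 0"
  then obtain c where c: "f = [:c:]" by (auto elim: degree_eq_zeroE)
  have "coeff f 0 \<in> K" using f unfolding polys_over_def by blast
  then show False using c f_trans algebraic_base[of c] by simp
qed

text \<open>The values at \<open>s\<close> of the possible remainders modulo the key polynomial.\<close>

definition M :: "'a set" where
  "M = {poly g s | g. g \<in> polys_over K \<and> degree g < degree f}"

lemma MI: "g \<in> polys_over K \<Longrightarrow> degree g < degree f \<Longrightarrow> poly g s \<in> M"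
  by (auto simp: M_def)

lemma M_add: "x \<in> M \<Longrightarrow> y \<in> M \<Longrightarrow> x + y \<in> M"
  unfolding M_def by clarify (metis poly_add polys_over_add[OF K] degree_add_less)

lemma M_uminus: "x \<in> M \<Longrightarrow> - x \<in> M"
  unfolding M_def by clarify (metis poly_minus polys_over_uminus[OF K] degree_minus)

lemma M_base: "K \<subseteq> M"
  using MI[OF polys_over_const[OF K]] degree_f by force

lemma M_algebraic: "x \<in> M \<Longrightarrow> algebraic_ord_lc x"
  using f_minimal by (auto simp: M_def)

lemma mult_\<phi>_transcendental: "x \<in> M \<Longrightarrow> x \<noteq> 0 \<Longrightarrow> \<not> algebraic_ord_lc (x * \<phi>)"
  using algebraic_multD[of x \<phi>] \<phi>0 M_algebraic f_trans by blast

text \<open>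
  On division of \<open>g h\<close> by the key polynomial, the multiple of \<open>\<phi>\<close> cannot reach the order of the
  remainder, since it would then have an algebraic leading coefficient. So the remainder has the
  order and the leading coefficient of \<open>g h\<close>.
\<close>

lemma M_mult:
  assumes "g \<in> M" "h \<in> M" "g \<noteq> 0" "h \<noteq> 0"
  obtains r where "r \<in> M" "r \<noteq> 0" "ord r = ord g + ord h" "lc r = lc g * lc h"
proof -
  from assms obtain G H where GH: "g = poly G s" "G \<in> polys_over K" "degree G < degree f"
    "h = poly H s" "H \<in> polys_over K" "degree H < degree f" by (auto simp: M_def)
  obtain Q R where QR: "Q \<in> polys_over K" "R \<in> polys_over K" "G * H = Q * f + R"
    "degree R < degree f" "Q \<noteq> 0 \<Longrightarrow> degree (G * H) = degree Q + degree f"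
    using polys_over_division[OF K polys_over_mult[OF K GH(2,5)] f degree_f] by blast
  define q r where "q = poly Q s" and "r = poly R s"
  have "degree (G * H) < 2 * degree f" using degree_mult_le[of G H] GH(3,6) by linarith
  then have "degree Q < degree f" using QR(5) degree_f by (cases "Q = 0") auto
  then have qM: "q \<in> M" and rM: "r \<in> M" using QR MI by (auto simp: q_def r_def)
  have gh: "g * h = q * \<phi> + r"
    using arg_cong[OF QR(3), of "\<lambda>p. poly p s"] by (simp add: GH q_def r_def)
  have gh0: "g * h \<noteq> 0" and gh_alg: "algebraic_ord_lc (g * h)"
    using assms algebraic_mult M_algebraic by auto
  have "r \<noteq> 0 \<and> ord (g * h) = ord r \<and> lc (g * h) = lc r"
  proof (cases "q = 0")
    case True
    then show ?thesis using gh gh0 by auto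
  next
    case False
    let ?x = "q * \<phi>"
    have x0: "?x \<noteq> 0" using False \<phi>0 by simp
    have x: "\<not> algebraic_ord_lc ?x" using mult_\<phi>_transcendental qM False by blast
    have less: "\<not> (r = 0 \<or> ord ?x < ord r)"
    proof
      assume "r = 0 \<or> ord ?x < ord r"
      then have "ord (g * h) = ord ?x" "lc (g * h) = lc ?x"
        using add_dominant[OF x0, of r] gh by auto
      then show False using x gh_alg algebraic_cong by blast
    qed
    then have r0: "r \<noteq> 0" by simp
    have "ord r \<noteq> ord ?x"
    proof
      assume eq: "ord r = ord ?x"
      show False
      proof (cases "lc ?x + lc r = 0")
        case True
        then have "lc ?x = lc (- r)" by (simp add: lc_minus eq_neg_iff_add_eq_0)
        then show False
          using x M_algebraic[OF M_uminus[OF rM]] eq algebraic_cong[of ?x "- r"] by (simp add: ord_minus)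
      next
        case False
        then have gh': "ord (g * h) = ord r" "lc (g * h) = lc ?x + lc r"
          using add_nondegenerate[OF x0 r0] eq gh by auto
        have "lc ?x / lc r = lc (g * h) / lc r - 1" using gh' r0 by (simp add: field_simps)
        moreover have "lc (g * h) / lc r \<in> A"
          using algebraic_quotient[OF gh'(1) gh0 r0] gh_alg M_algebraic[OF rM] by blast
        ultimately have "lc ?x / lc r \<in> A" using subfield_diff[OF A _ subfield_1[OF A]] by auto
        then show False using x algebraic_quotient[OF eq[symmetric] x0 r0] M_algebraic[OF rM] by blast
      qed
    qed
    then have "ord r < ord ?x" using less by auto
    then show ?thesis using add_dominant[OF r0, of ?x] gh r0 by (auto simp: add.commute)
  qed
  then show ?thesis using that rM assms by (auto simp: ord_mult lc_mult)
qed

text \<open>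
  By the preceding lemma the pairs of order and leading coefficient of quotients of elements of
  \<open>M\<close> form a group, and those of order zero together with \<open>0\<close> form a field: the algebraic part of
  the residue field.
\<close>

definition low :: "int \<Rightarrow> 'c \<Rightarrow> bool" where
  "low i c \<longleftrightarrow> (\<exists>g\<in>M. \<exists>h\<in>M. g \<noteq> 0 \<and> h \<noteq> 0 \<and> i = ord g - ord h \<and> c = lc g / lc h)"

lemma low_nonzero: "low i c \<Longrightarrow> c \<noteq> 0"
  by (auto simp: low_def)

lemma one_M: "1 \<in> M"
  using M_base subfield_1[OF K] by blast

lemma low_M: "g \<in> M \<Longrightarrow> g \<noteq> 0 \<Longrightarrow> low (ord g) (lc g)"
  unfolding low_def using one_M by (intro bexI[of _ g] bexI[of _ 1]) auto

lemma low_inverse: "low i c \<Longrightarrow> low (- i) (inverse c)"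
  unfolding low_def by (metis inverse_divide minus_diff_eq)

lemma low_mult:
  assumes "low i c" "low j d"
  shows "low (i + j) (c * d)"
proof -
  from assms obtain g h g' h' where *: "g \<in> M" "h \<in> M" "g \<noteq> 0" "h \<noteq> 0" "i = ord g - ord h"
    "c = lc g / lc h" "g' \<in> M" "h' \<in> M" "g' \<noteq> 0" "h' \<noteq> 0" "j = ord g' - ord h'" "d = lc g' / lc h'"
    unfolding low_def by blast
  obtain r where r: "r \<in> M" "r \<noteq> 0" "ord r = ord g + ord g'" "lc r = lc g * lc g'"
    using M_mult * by metis
  obtain r' where r': "r' \<in> M" "r' \<noteq> 0" "ord r' = ord h + ord h'" "lc r' = lc h * lc h'"
    using M_mult * by metis
  show ?thesis unfolding low_def
    using r r' * by (intro bexI[of _ r] bexI[of _ r']) auto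
qed

lemma low_diff: "low i c \<Longrightarrow> low j d \<Longrightarrow> low (i - j) (c / d)"
  using low_mult[OF _ low_inverse] by (simp add: divide_inverse)

lemma low_1: "low 0 1"
  using low_M[OF one_M] by simp

lemma low_power: "low i c \<Longrightarrow> low (int n * i) (c ^ n)"
  by (induction n) (auto simp: low_1 distrib_right intro: low_mult)

lemma low_power_int:
  assumes "low i c" shows "low (d * i) (c powi d)"
proof (cases "d \<ge> 0")
  case True
  then show ?thesis using low_power[OF assms, of "nat d"] by (simp add: power_int_def)
next
  case False
  then show ?thesis using low_power[OF low_inverse[OF assms], of "nat (- d)"]
    by (simp add: power_int_def)
qed

lemma low_add:
  assumes "low i c" "low i d" "c + d \<noteq> 0"
  shows "low i (c + d)"
proof -
  from assms obtain g h g' h' where *: "g \<in> M" "h \<in> M" "g \<noteq> 0" "h \<noteq> 0" "i = ord g - ord h"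
    "c = lc g / lc h" "g' \<in> M" "h' \<in> M" "g' \<noteq> 0" "h' \<noteq> 0" "i = ord g' - ord h'" "d = lc g' / lc h'"
    unfolding low_def by blast
  obtain r1 where r1: "r1 \<in> M" "r1 \<noteq> 0" "ord r1 = ord g + ord h'" "lc r1 = lc g * lc h'"
    using M_mult * by metis
  obtain r2 where r2: "r2 \<in> M" "r2 \<noteq> 0" "ord r2 = ord g' + ord h" "lc r2 = lc g' * lc h"
    using M_mult * by metis
  obtain r3 where r3: "r3 \<in> M" "r3 \<noteq> 0" "ord r3 = ord h + ord h'" "lc r3 = lc h * lc h'"
    using M_mult * by metis
  have cd: "c + d = (lc r1 + lc r2) / lc r3"
    unfolding *(6,12) r1 r2 r3 using * by (subst add_frac_eq) auto
  then have "lc r1 + lc r2 \<noteq> 0" using assms(3) by auto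
  moreover have "ord r1 = ord r2" using * r1 r2 by simp
  ultimately have sum: "r1 + r2 \<noteq> 0" "ord (r1 + r2) = ord r1" "lc (r1 + r2) = lc r1 + lc r2"
    using add_nondegenerate r1 r2 by auto
  show ?thesis unfolding low_def
    using r1 r3 sum cd * M_add[OF r1(1) r2(1)]
    by (intro bexI[of _ "r1 + r2"] bexI[of _ r3]) auto
qed

lemma low_algebraic:
  assumes "low i c" shows "norm_res i c \<in> A"
proof -
  from assms obtain g h where *: "g \<in> M" "h \<in> M" "i = ord g - ord h" "c = lc g / lc h"
    unfolding low_def by blast
  show ?thesis unfolding *(3,4) norm_res_diff
    using M_algebraic * by (intro subfield_divide[OF A]) (auto simp: algebraic_ord_lc_def)
qed

definition k' :: "'c set" where "k' = insert 0 {c. low 0 c}"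

lemma low_k': "low 0 c \<Longrightarrow> c \<in> k'"
  by (simp add: k'_def)

lemma is_subfield_k': "is_subfield k'"
  unfolding is_subfield_def
proof (intro conjI ballI)
  show "0 \<in> k'" "1 \<in> k'" using low_1 by (auto simp: k'_def)
  have m1: "low 0 (- 1)"
    using low_M[of "- 1"] M_uminus[OF one_M] by (simp add: ord_minus lc_minus)
  fix x assume x: "x \<in> k'"
  show "- x \<in> k'" using x low_mult[OF m1, of 0 x] by (auto simp: k'_def)
  show "inverse x \<in> k'" using x low_inverse[of 0 x] by (auto simp: k'_def)
  fix y assume y: "y \<in> k'"
  show "x + y \<in> k'" using x y low_add[of 0 x y] by (auto simp: k'_def)
  show "x * y \<in> k'" using x y low_mult[of 0 x 0 y] by (auto simp: k'_def)
qed

lemma residues_base_k': "residues K \<subseteq> k'"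
  using low_M M_base by (auto simp: residues_def k'_def) (metis subsetD)

lemma k'_algebraic: "k' \<subseteq> A"
  using low_algebraic[of 0] A_root[of _ m] m subfield_0[OF A] by (auto simp: k'_def norm_res_0)

text \<open>The index of the value group of \<open>M\<close> in the value group that \<open>\<phi>\<close> generates with it.\<close>

definition e :: nat where "e = (LEAST n. n > 0 \<and> (\<exists>c. low (int n * ord \<phi>) c))"

lemma e: "e > 0" "\<exists>c. low (int e * ord \<phi>) c"
proof -
  have "low (ord (a powi ord \<phi>)) (lc (a powi ord \<phi>))"
    using a a0 M_base subfield_power_int[OF K] by (intro low_M) auto
  then have "low (int m * ord \<phi>) (lc (a powi ord \<phi>))" using m by (simp add: ord_power_int mult.commute)
  then have "\<exists>n. n > 0 \<and> (\<exists>c. low (int n * ord \<phi>) c)" using m by blast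
  from LeastI_ex[OF this] show "e > 0" "\<exists>c. low (int e * ord \<phi>) c" by (auto simp: e_def)
qed

text \<open>
  Two possible values differ by a factor from \<open>k'\<close>, so the choice does not affect the field that
  \<open>y\<close> generates over \<open>k'\<close>.
\<close>

definition c0 :: 'c where "c0 = (SOME c. low (int e * ord \<phi>) c)"

lemma c0: "low (int e * ord \<phi>) c0"
  unfolding c0_def by (rule someI_ex[OF e(2)])

lemma e_dvd:
  assumes "low (i * ord \<phi>) c"
  shows "int e dvd i"
proof (rule ccontr)
  assume nd: "\<not> int e dvd i"
  define r where "r = nat (i mod int e)"
  have r: "int r = i mod int e" "r > 0" "r < e"
    using nd e(1) by (auto simp: r_def dvd_eq_mod_eq_0 nat_less_iff) (metis nd mod_0_imp_dvd of_nat_0_less_iff order_le_less pos_mod_sign)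
  have "low (i * ord \<phi> - (i div int e) * (int e * ord \<phi>)) (c / c0 powi (i div int e))"
    by (intro low_diff assms low_power_int c0)
  moreover have "i * ord \<phi> - (i div int e) * (int e * ord \<phi>) = int r * ord \<phi>"
    unfolding r(1) by (simp add: minus_div_mult_eq_mod[symmetric] algebra_simps)
  ultimately have "r > 0 \<and> (\<exists>c. low (int r * ord \<phi>) c)" using r by auto
  then have "e \<le> r" unfolding e_def by (rule Least_le)
  then show False using r by simp
qed

text \<open>The residue of \<open>\<phi>^e\<close> divided by a quotient of elements of \<open>M\<close> that has the same order.\<close>

definition y :: 'c where "y = lc \<phi> ^ e / c0"

lemma lc_\<phi>_power: "lc \<phi> powi (int e * d) = c0 powi d * y powi d"
  using low_nonzero[OF c0] by (simp add: y_def power_int_mult power_int_divide_distrib)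

lemma y_transcendental: "y \<notin> alg_closure k'"
proof
  assume "y \<in> alg_closure k'"
  then have yA: "y \<in> A" using alg_closure_mono[OF k'_algebraic] A_idem by blast
  have "norm_res (int e * ord \<phi>) (lc \<phi> ^ e) = norm_res (int e * ord \<phi>) c0 * y ^ m"
    using norm_res_mult[of "int e * ord \<phi>" 0 c0 y] low_nonzero[OF c0]
    by (simp add: norm_res_0 y_def)
  also have "\<dots> \<in> A" using low_algebraic[OF c0] yA by (intro subfield_mult[OF A] subfield_power[OF A])
  finally have "norm_res (ord \<phi>) (lc \<phi>) \<in> A" using A_root e(1) by (simp add: norm_res_power)
  then show False using f_trans by (simp add: algebraic_ord_lc_def)
qed

lemma poly_y_nonzero: "P \<in> polys_over k' \<Longrightarrow> P \<noteq> 0 \<Longrightarrow> poly P y \<noteq> 0"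
  using y_transcendental by (auto simp: alg_closure_def)

text \<open>
  In the expansion of \<open>G\<close> in powers of the key polynomial, the terms of minimal order have
  exponents in one class modulo \<open>e\<close>, so their leading coefficients add up to a nonzero polynomial
  in \<open>y\<close>.
\<close>

lemma initial_form:
  assumes "G \<in> polys_over K" "poly G s \<noteq> 0"
  shows "\<exists>j c i P. low j c \<and> P \<in> polys_over k' \<and> poly P y \<noteq> 0 \<and>
    ord (poly G s) = j + int i * ord \<phi> \<and> lc (poly G s) = c * lc \<phi> ^ i * poly P y"
  using assms
proof (induction "degree G" arbitrary: G rule: less_induct)
  case less
  have lowI: "\<exists>j c i P. low j c \<and> P \<in> polys_over k' \<and> poly P y \<noteq> 0 \<and>
    ord R = j + int i * ord \<phi> \<and> lc R = c * lc \<phi> ^ i * poly P y" if "R \<in> M" "R \<noteq> 0" for R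
    using low_M[OF that] polys_over_1[OF is_subfield_k']
    by (intro exI[of _ "ord R"] exI[of _ "lc R"] exI[of _ 0] exI[of _ 1]) auto
  obtain q r where qr: "q \<in> polys_over K" "r \<in> polys_over K" "G = q * f + r"
    "degree r < degree f" "q \<noteq> 0 \<Longrightarrow> degree G = degree q + degree f"
    using polys_over_division[OF K less.prems(1) f degree_f] by blast
  define X R where "X = poly q s * \<phi>" and "R = poly r s"
  have RM: "R \<in> M" using MI qr by (simp add: R_def)
  have G: "poly G s = X + R" by (simp add: qr(3) X_def R_def)
  show ?case
  proof (cases "X = 0")
    case True
    then show ?thesis using lowI[OF RM] less.prems G by auto
  next
    case False
    then have q0: "poly q s \<noteq> 0" by (auto simp: X_def)
    then have "degree q < degree G" using qr(5) degree_f by fastforce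
    from less.hyps[OF this qr(1) q0] obtain j c i P where IH: "low j c" "P \<in> polys_over k'"
      "poly P y \<noteq> 0" "ord (poly q s) = j + int i * ord \<phi>" "lc (poly q s) = c * lc \<phi> ^ i * poly P y"
      by blast
    have oX: "ord X = j + int (Suc i) * ord \<phi>" and lX: "lc X = c * lc \<phi> ^ Suc i * poly P y"
      using IH q0 \<phi>0 by (simp_all add: X_def ord_mult lc_mult algebra_simps)
    consider "R = 0 \<or> ord X < ord R" | "R \<noteq> 0" "ord R < ord X" | "R \<noteq> 0" "ord R = ord X" by linarith
    then show ?thesis
    proof cases
      case 1
      then have "ord (poly G s) = ord X" "lc (poly G s) = lc X" using add_dominant[OF False] G by auto
      then show ?thesis using IH(1,2,3) oX lX by metis
    next
      case 2
      then have "ord (poly G s) = ord R" "lc (poly G s) = lc R"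
        using add_dominant[of R X] G by (auto simp: add.commute)
      then show ?thesis using lowI[OF RM 2(1)] by metis
    next
      case 3
      have lR: "low (ord R) (lc R)" using low_M[OF RM 3(1)] .
      have "low (int (Suc i) * ord \<phi>) (lc R / c)"
        using low_diff[OF lR IH(1)] 3 oX by (simp add: algebra_simps)
      then obtain d where d: "int (Suc i) = int e * int d"
        using e_dvd int_dvd_int_iff by (metis dvdE of_nat_mult)
      then have d': "Suc i = e * d" by (metis of_nat_eq_iff of_nat_mult)
      then have d0: "d > 0" by (cases d) auto
      define \<kappa> where "\<kappa> = c * c0 ^ d / lc R"
      have "low (j + int d * (int e * ord \<phi>) - ord R) \<kappa>" unfolding \<kappa>_def
        by (intro low_diff low_mult IH(1) low_power c0 lR)
      moreover have "j + int d * (int e * ord \<phi>) - ord R = 0"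
        using 3(2) oX d by (simp add: mult_ac)
      ultimately have \<kappa>: "\<kappa> \<in> k'" using low_k' by simp
      have lX': "lc X = lc R * (\<kappa> * y ^ d * poly P y)"
        using 3(1) low_nonzero[OF c0] by (simp add: lX d' \<kappa>_def y_def power_mult power_divide)
      define P' where "P' = 1 + smult \<kappa> (monom 1 d * P)"
      have P'k: "P' \<in> polys_over k'" unfolding P'_def
        using \<kappa> IH(2) is_subfield_k'
        by (intro polys_over_add polys_over_1 polys_over_smult polys_over_mult polys_over_monom subfield_1)
      have "coeff P' 0 = 1" using d0 by (simp add: P'_def coeff_monom_mult)
      then have "P' \<noteq> 0" by auto
      then have P'0: "poly P' y \<noteq> 0" using poly_y_nonzero P'k by blast
      have sum: "lc X + lc R = lc R * poly P' y"
        by (simp add: lX' P'_def poly_monom algebra_simps)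
      then have "ord (poly G s) = ord R" "lc (poly G s) = lc R * poly P' y"
        using add_nondegenerate[OF False 3(1)] 3 P'0 G by auto
      then show ?thesis using lR P'k P'0
        by (intro exI[of _ "ord R"] exI[of _ "lc R"] exI[of _ 0] exI[of _ P']) auto
    qed
  qed
qed

lemma residues_eq: "residues (adjoin K {s}) = adjoin k' {y}"
proof (rule subset_antisym)
  let ?E = "adjoin k' {y}"
  have E: "is_subfield ?E" by (rule is_subfield_adjoin)
  have yE: "y \<in> ?E" and kE: "k' \<subseteq> ?E" using adjoin_gen[of "{y}" k'] adjoin_base[of k'] by auto
  have PE: "poly P y \<in> ?E" if "P \<in> polys_over k'" for P
    using poly_in_subfield[OF E _ yE] polys_over_mono[OF kE] that by blast
  show "residues (adjoin K {s}) \<subseteq> ?E"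
  proof
    fix u assume "u \<in> residues (adjoin K {s})"
    then consider "u = 0" | x where "x \<in> adjoin K {s}" "x \<noteq> 0" "ord x = 0" "u = lc x"
      by (auto simp: residues_def)
    then show "u \<in> ?E"
    proof cases
      case 2
      then obtain G H where GH: "x = poly G s / poly H s" "G \<in> polys_over K" "H \<in> polys_over K"
        "poly H s \<noteq> 0" unfolding adjoin_singleton[OF K] by auto
      have G0: "poly G s \<noteq> 0" using 2 GH by auto
      obtain j c i P where h1: "low j c" "P \<in> polys_over k'"
        "ord (poly G s) = j + int i * ord \<phi>" "lc (poly G s) = c * lc \<phi> ^ i * poly P y"
        using initial_form[OF GH(2) G0] by blast
      obtain j' c' i' P' where h2: "low j' c'" "P' \<in> polys_over k'"
        "ord (poly H s) = j' + int i' * ord \<phi>" "lc (poly H s) = c' * lc \<phi> ^ i' * poly P' y"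
        using initial_form[OF GH(3,4)] by blast
      have "ord (poly G s) = ord (poly H s)" using 2 GH G0 by (simp add: ord_divide)
      then have *: "(int i - int i') * ord \<phi> = j' - j" using h1 h2 by (simp add: algebra_simps)
      then have "int e dvd int i - int i'" using e_dvd low_diff[OF h2(1) h1(1)] by metis
      then obtain d where d: "int i - int i' = int e * d" by (elim dvdE)
      have "low (j - j' + d * (int e * ord \<phi>)) (c / c' * c0 powi d)"
        by (intro low_mult low_diff low_power_int h1 h2 c0)
      moreover have "j - j' + d * (int e * ord \<phi>) = 0" using * d by (simp add: mult_ac)
      ultimately have k: "c / c' * c0 powi d \<in> k'" using low_k' by simp
      have "lc \<phi> ^ i / lc \<phi> ^ i' = lc \<phi> powi (int i - int i')" using \<phi>0 by (simp add: power_int_diff)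
      then have q: "lc \<phi> ^ i / lc \<phi> ^ i' = c0 powi d * y powi d" unfolding d lc_\<phi>_power .
      have "u = c / c' * (lc \<phi> ^ i / lc \<phi> ^ i') * (poly P y / poly P' y)"
        unfolding 2(4) GH(1) lc_divide h1(4) h2(4) by simp
      then have "u = (c / c' * c0 powi d) * y powi d * (poly P y / poly P' y)"
        unfolding q by (simp only: mult.assoc)
      moreover have "c / c' * c0 powi d \<in> ?E" using k kE by blast
      then have "(c / c' * c0 powi d) * y powi d * (poly P y / poly P' y) \<in> ?E"
        using PE[OF h1(2)] PE[OF h2(2)] yE
        by (intro subfield_mult[OF E, of "_ * y powi d"] subfield_mult[OF E, of _ "y powi d"]
            subfield_divide[OF E, of "poly P y"] subfield_power_int[OF E])
      ultimately show ?thesis by simp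
    qed (simp add: subfield_0[OF E])
  qed
next
  have L: "is_subfield (adjoin K {s})" by (rule is_subfield_adjoin)
  have KL: "K \<subseteq> adjoin K {s}" and sL: "s \<in> adjoin K {s}"
    using adjoin_base[of K "{s}"] adjoin_gen[of "{s}" K] by auto
  have polyL: "poly g s \<in> adjoin K {s}" if "g \<in> polys_over K" for g
    using poly_in_subfield[OF L _ sL] polys_over_mono[OF KL] that by blast
  have MsubL: "M \<subseteq> adjoin K {s}" using polyL by (auto simp: M_def)
  show "adjoin k' {y} \<subseteq> residues (adjoin K {s})"
  proof (intro adjoin_least is_subfield_residues L)
    show "k' \<subseteq> residues (adjoin K {s})"
    proof
      fix c assume "c \<in> k'"
      then consider "c = 0" | g h where "g \<in> M" "h \<in> M" "g \<noteq> 0" "h \<noteq> 0" "ord g = ord h" "c = lc g / lc h"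
        by (auto simp: k'_def low_def)
      then show "c \<in> residues (adjoin K {s})"
      proof cases
        case 2
        then show ?thesis
          using residuesI[of "g / h" "adjoin K {s}"] subfield_divide[OF L] MsubL
          by (auto simp: lc_divide ord_divide)
      qed (simp add: residues_def)
    qed
    obtain g h where gh: "g \<in> M" "h \<in> M" "g \<noteq> 0" "h \<noteq> 0" "int e * ord \<phi> = ord g - ord h" "c0 = lc g / lc h"
      using c0 by (auto simp: low_def)
    have "\<phi> ^ e / (g / h) \<in> adjoin K {s}"
      using gh MsubL polyL[OF f] by (intro subfield_divide[OF L] subfield_power[OF L]) auto
    moreover have "ord (\<phi> ^ e / (g / h)) = 0"
      using gh \<phi>0 by (subst ord_divide) (auto simp: ord_divide ord_power)
    moreover have "lc (\<phi> ^ e / (g / h)) = y" by (simp add: lc_divide lc_mult lc_power y_def gh)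
    ultimately show "{y} \<subseteq> residues (adjoin K {s})" using residuesI by fastforce
  qed
qed

end

context valued_simple_extension
begin

text \<open>
  The residue field of \<open>K(s)\<close> is algebraic over that of \<open>K\<close> or ruled over it. If all values of
  polynomials at \<open>s\<close> are residually algebraic, then so are their quotients; otherwise there is a
  key polynomial.
\<close>

theorem ruled_residue_field:
  "residues (adjoin K {s}) \<subseteq> A \<or>
   (\<exists>k' y. is_subfield k' \<and> residues K \<subseteq> k' \<and> y \<notin> alg_closure k' \<and>
      residues (adjoin K {s}) = adjoin k' {y})"
proof (cases "\<forall>g\<in>polys_over K. algebraic_ord_lc (poly g s)")
  case True
  have "residues (adjoin K {s}) \<subseteq> A"
  proof
    fix u assume "u \<in> residues (adjoin K {s})"
    then consider "u = 0" | x where "x \<in> adjoin K {s}" "x \<noteq> 0" "ord x = 0" "u = lc x"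
      by (auto simp: residues_def)
    then show "u \<in> A"
    proof cases
      case 2
      then obtain G H where GH: "x = poly G s / poly H s" "G \<in> polys_over K" "H \<in> polys_over K"
        "poly H s \<noteq> 0" unfolding adjoin_singleton[OF K] by auto
      have G0: "poly G s \<noteq> 0" using 2 GH by auto
      have eq: "ord (poly G s) = ord (poly H s)" using 2 GH G0 by (simp add: ord_divide)
      show ?thesis using algebraic_quotient[OF eq G0 GH(4)] True GH(2,3) 2(4) GH(1)
        by (simp add: lc_divide)
    qed (simp add: subfield_0[OF A])
  qed
  then show ?thesis ..
next
  case False
  define P where "P n \<longleftrightarrow> (\<exists>g\<in>polys_over K. \<not> algebraic_ord_lc (poly g s) \<and> degree g = n)" for n
  have "\<exists>n. P n" using False by (auto simp: P_def)
  then obtain n where n: "P n" "\<And>i. i < n \<Longrightarrow> \<not> P i" using exists_least_iff[of P] by blast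
  then obtain f where f: "f \<in> polys_over K" "\<not> algebraic_ord_lc (poly f s)" "degree f = n"
    by (auto simp: P_def)
  interpret key_polynomial V K a s f
    using f n(2) by unfold_locales (auto simp: P_def)
  show ?thesis using is_subfield_k' residues_base_k' y_transcendental residues_eq by blast
qed

end

section \<open>Lifting a transcendence basis of the residue field\<close>

context laurent_embedding
begin

definition trivially_valued :: "'a set \<Rightarrow> bool" where
  "trivially_valued F \<longleftrightarrow> (\<forall>x\<in>F. ord x = 0)"

text \<open>In a polynomial in an element of positive order the nonzero term of lowest degree dominates.\<close>

lemma trivially_valued_positive_transcendental:
  assumes F: "trivially_valued F" and a: "ord a > 0"
  shows "a \<notin> alg_closure F"
proof
  assume "a \<in> alg_closure F"
  then obtain p where p: "p \<in> polys_over F" "p \<noteq> 0" "poly p a = 0" by (auto simp: alg_closure_def)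
  have a0: "a \<noteq> 0" using a by auto
  have "poly q a \<noteq> 0 \<and> ord (poly q a) \<ge> 0" if "q \<in> polys_over F" "q \<noteq> 0" for q
    using that
  proof (induction q)
    case (pCons c q)
    have c: "c \<in> F" and q: "q \<in> polys_over F"
      using polys_over_pConsD pCons.prems by blast+
    have oc: "ord c = 0" using F c by (simp add: trivially_valued_def)
    show ?case
    proof (cases "q = 0")
      case True
      then show ?thesis using pCons.prems oc by simp
    next
      case False
      then have IH: "poly q a \<noteq> 0" "ord (poly q a) \<ge> 0" using pCons.IH q by auto
      then have X: "a * poly q a \<noteq> 0" "ord (a * poly q a) > 0" using a a0 by (auto simp: ord_mult)
      show ?thesis
      proof (cases "c = 0")
        case True
        then show ?thesis using X by simp
      next
        case False
        then show ?thesis using add_dominant[of c "a * poly q a"] X oc by simp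
      qed
    qed
  qed simp
  then show False using p by blast
qed

lemma trivially_valued_transcendental:
  assumes F: "trivially_valued F" "is_subfield F" and a: "ord a \<noteq> 0"
  shows "a \<notin> alg_closure F"
proof (cases "ord a > 0")
  case False
  then have "inverse a \<notin> alg_closure F"
    using a by (intro trivially_valued_positive_transcendental[OF F(1)]) (simp add: ord_inverse)
  then show ?thesis using subfield_inverse[OF is_subfield_alg_closure[OF F(2)], of a] by auto
qed (rule trivially_valued_positive_transcendental[OF F(1)])

text \<open>
  Unlike \<open>lc\<close>, the coefficient of order zero is additive and multiplicative on the whole valuation
  ring.
\<close>

definition res :: "'a \<Rightarrow> 'c" where "res x = fls_nth (V x) 0"

lemma res_eq_lc: "ord x = 0 \<Longrightarrow> res x = lc x"
  by (simp add: res_def lc_def)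

lemma ord_eq_0_iff_res: "ord x \<ge> 0 \<Longrightarrow> res x \<noteq> 0 \<Longrightarrow> ord x = 0"
  unfolding res_def ord_def by (meson fls_subdegree_leI order_antisym)

lemma integral_add: "ord x \<ge> 0 \<Longrightarrow> ord y \<ge> 0 \<Longrightarrow> ord (x + y) \<ge> 0 \<and> res (x + y) = res x + res y"
  by (auto simp: ord_def res_def V_add intro!: fls_subdegree_ge0I)

lemma integral_mult:
  assumes "ord x \<ge> 0" "ord y \<ge> 0"
  shows "ord (x * y) \<ge> 0 \<and> res (x * y) = res x * res y"
proof (cases "x = 0 \<or> y = 0")
  case False
  then have o: "ord (x * y) = ord x + ord y" by (simp add: ord_mult)
  show ?thesis
  proof (cases "ord x = 0 \<and> ord y = 0")
    case True
    then show ?thesis using o by (simp add: res_eq_lc lc_mult)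
  next
    case False
    then have "ord (x * y) > 0" "ord x > 0 \<or> ord y > 0" using o assms by auto
    then show ?thesis by (auto simp: res_def ord_def)
  qed
qed (auto simp: res_def V_0)

text \<open>
  Reduction commutes with evaluation of polynomials, so a polynomial relation of a unit over a
  trivially valued field would reduce to one of its residue.
\<close>

lemma trivially_valued_adjoin:
  assumes F: "is_subfield F" "trivially_valued F"
    and y: "ord y = 0" "lc y \<notin> alg_closure (residues F)"
  shows "y \<notin> alg_closure F" and "trivially_valued (adjoin F {y})"
    and "residues (adjoin F {y}) \<subseteq> adjoin (residues F) {lc y}"
proof -
  have red: "ord (poly p y) \<ge> 0 \<and> res (poly p y) = poly (map_poly lc p) (lc y)"
    if "p \<in> polys_over F" for p
    using that
  proof (induction p)
    case (pCons c p)
    have c: "c \<in> F" and p: "p \<in> polys_over F"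
      using polys_over_pConsD pCons.prems by blast+
    have oc: "ord c = 0" using F c by (simp add: trivially_valued_def)
    have "ord (y * poly p y) \<ge> 0 \<and> res (y * poly p y) = lc y * poly (map_poly lc p) (lc y)"
      using integral_mult[of y "poly p y"] pCons.IH p y(1) by (auto simp: res_eq_lc)
    then show ?case using integral_add[of c "y * poly p y"] oc
      by (auto simp: map_poly_pCons res_eq_lc)
  qed (simp add: res_def V_0)
  have over: "map_poly lc p \<in> polys_over (residues F)" if "p \<in> polys_over F" for p
    using that F(2) by (auto simp: polys_over_def coeff_map_poly trivially_valued_def intro!: residuesI)
  have unit: "ord (poly p y) = 0 \<and> poly p y \<noteq> 0 \<and> lc (poly p y) = poly (map_poly lc p) (lc y)"
    if p: "p \<in> polys_over F" "p \<noteq> 0" for p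
  proof -
    have "coeff (map_poly lc p) (degree p) \<noteq> 0" using p(2) by (simp add: coeff_map_poly)
    then have "map_poly lc p \<noteq> 0" by auto
    then have "poly (map_poly lc p) (lc y) \<noteq> 0" using y(2) over[OF p(1)] by (auto simp: alg_closure_def)
    then have "ord (poly p y) = 0" "res (poly p y) \<noteq> 0" using red[OF p(1)] ord_eq_0_iff_res by auto
    then show ?thesis using red[OF p(1)] by (auto simp: res_eq_lc)
  qed
  show "y \<notin> alg_closure F" using unit by (auto simp: alg_closure_def)
  have el: "ord x = 0 \<and> (x = 0 \<or> lc x \<in> adjoin (residues F) {lc y})" if x: "x \<in> adjoin F {y}" for x
  proof (cases "x = 0")
    case False
    then obtain p q where pq: "x = poly p y / poly q y" "p \<in> polys_over F" "q \<in> polys_over F"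
      "poly q y \<noteq> 0" using x unfolding adjoin_singleton[OF F(1)] by auto
    then have "p \<noteq> 0" "q \<noteq> 0" using False by auto
    note p = unit[OF pq(2) this(1)] and q = unit[OF pq(3) this(2)]
    have "lc x = poly (map_poly lc p) (lc y) / poly (map_poly lc q) (lc y)"
      "poly (map_poly lc q) (lc y) \<noteq> 0" using p q lc_eq_0_iff[of "poly q y"]
      by (simp_all add: pq(1) lc_divide)
    then have "lc x \<in> adjoin (residues F) {lc y}"
      unfolding adjoin_singleton[OF is_subfield_residues[OF F(1)]]
      using over[OF pq(2)] over[OF pq(3)] by blast
    moreover have "ord x = 0" using p q by (simp add: pq(1) ord_divide)
    ultimately show ?thesis by blast
  qed simp
  show "trivially_valued (adjoin F {y})" using el by (auto simp: trivially_valued_def)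
  show "residues (adjoin F {y}) \<subseteq> adjoin (residues F) {lc y}"
    using el subfield_0[OF is_subfield_adjoin] by (auto simp: residues_def)
qed

end

text \<open>
  Abhyankar's inequality in the case at hand: a transcendence basis of the residue field of \<open>K\<close>
  lifts to \<open>K\<close>, and an element of nonzero order remains transcendental over the lift. With \<open>s\<close>
  there would be two more independent elements than the basis has, whereas \<open>E(t)\<close> allows for only
  one more.
\<close>

lemma residue_extension_not_algebraic:
  fixes V :: "'a::field \<Rightarrow> 'a fls"
  assumes V: "laurent_embedding V"
    and k: "is_subfield k" "\<And>c. c \<in> k \<Longrightarrow> V c = fls_const c" and fin: "trdeg k UNIV < \<infinity>"
    and K: "is_subfield K" "k \<subseteq> K" and a: "a \<in> K" "laurent_embedding.ord V a \<noteq> 0"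
    and s: "s \<notin> alg_closure K" and t: "adjoin E {t} = UNIV"
  shows "\<not> E \<subseteq> alg_closure (laurent_embedding.residues V K)"
proof
  interpret laurent_embedding V by (rule V)
  interpret pregeometry "\<lambda>S. alg_closure (adjoin k S)" by (rule pregeometry_alg_closure)
  assume E: "E \<subseteq> alg_closure (residues K)"
  have k_ord: "ord c = 0" "lc c = c" if "c \<in> k" for c
    using k(2)[OF that] by (simp_all add: ord_def lc_def)
  obtain I where I: "finite I" "I \<subseteq> residues K" "indep I" "residues K \<subseteq> alg_closure (adjoin k I)"
    using exists_transcendence_basis[OF fin, of "residues K"] by blast
  have lift: "\<exists>J. finite J \<and> J \<subseteq> K \<and> card J = card I' \<and> indep J \<and> trivially_valued (adjoin k J) \<and>
      residues (adjoin k J) \<subseteq> adjoin k I'" if "finite I'" "I' \<subseteq> residues K" "indep I'" for I'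
    using that
  proof (induction I' rule: finite_induct)
    case empty
    show ?case using k(1) k_ord indep_empty subfield_0[OF k(1)]
      by (intro exI[of _ "{}"]) (auto simp: adjoin_empty trivially_valued_def residues_def)
  next
    case (insert u I')
    then obtain J where J: "finite J" "J \<subseteq> K" "card J = card I'" "indep J"
      "trivially_valued (adjoin k J)" "residues (adjoin k J) \<subseteq> adjoin k I'"
      using indep_subset[OF insert.prems(2), of I'] by auto
    have u: "u \<notin> alg_closure (adjoin k I')" using indep_insertD insert by blast
    obtain y where y: "y \<in> K" "ord y = 0" "u = lc y"
      using residuesE[OF K(1)] insert.prems(1) by blast
    have "lc y \<notin> alg_closure (residues (adjoin k J))"
      using u y(3) alg_closure_mono[OF J(6)] by auto
    note ext = trivially_valued_adjoin[OF is_subfield_adjoin J(5) y(2) this]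
    have "y \<notin> J" using ext(1) cl_extensive[of J] by auto
    moreover have "residues (adjoin k (insert y J)) \<subseteq> adjoin k (insert u I')"
      unfolding adjoin_insert[of k _ J] adjoin_insert[of k _ I'] y(3)
      using ext(3) adjoin_mono[OF J(6), of "{lc y}"] by blast
    moreover have "trivially_valued (adjoin k (insert y J))"
      using ext(2) by (simp add: adjoin_insert[of k _ J])
    ultimately show ?case using J y insert.hyps indep_insert[OF J(4) ext(1)]
      by (intro exI[of _ "insert y J"]) auto
  qed
  obtain J where J: "finite J" "J \<subseteq> K" "card J = card I" "indep J" "trivially_valued (adjoin k J)"
    using lift[OF I(1,2,3)] by blast
  have a_cl: "a \<notin> alg_closure (adjoin k J)"
    using trivially_valued_transcendental[OF J(5) is_subfield_adjoin a(2)] .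
  have aJ: "a \<notin> J" using a_cl cl_extensive[of J] by auto
  have "adjoin k (insert a J) \<subseteq> K" using J(2) a(1) K by (intro adjoin_least) auto
  then have s_cl: "s \<notin> alg_closure (adjoin k (insert a J))" using s alg_closure_mono by blast
  then have sJ: "s \<notin> insert a J" using cl_extensive[of "insert a J"] by auto
  have "indep (insert s (insert a J))" using indep_insert[OF indep_insert[OF J(4) a_cl] s_cl] .
  moreover have "alg_closure (adjoin k (insert t I)) = UNIV"
  proof -
    let ?C = "alg_closure (adjoin k (insert t I))"
    have "alg_closure (residues K) \<subseteq> alg_closure (adjoin k I)"
      by (rule alg_closure_least[OF is_subfield_adjoin I(4)])
    also have "\<dots> \<subseteq> ?C" by (rule cl_mono) auto
    finally have "E \<subseteq> ?C" using E by blast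
    moreover have "t \<in> ?C" using cl_extensive[of "insert t I"] by auto
    ultimately have "adjoin E {t} \<subseteq> ?C"
      by (intro adjoin_least is_subfield_alg_closure is_subfield_adjoin) auto
    then show ?thesis unfolding t by blast
  qed
  ultimately have "card (insert s (insert a J)) \<le> card (insert t I)"
    using I(1) J(1) by (intro card_indep_le) auto
  also have "\<dots> \<le> Suc (card I)" using I(1) by (simp add: card_insert_if)
  finally show False using J(1,3) aJ sJ by simp
qed

section \<open>Locally nilpotent derivations\<close>

text \<open>
  The quotient of the images, independent of the representation of the fraction when \<open>h\<close> is
  multiplicative and vanishes only at \<open>0\<close>.
\<close>

definition fract_extension :: "('b::idom \<Rightarrow> 'c::field) \<Rightarrow> 'b fract \<Rightarrow> 'c" where
  "fract_extension h x = (SOME y. \<exists>a b. b \<noteq> 0 \<and> x = Fract a b \<and> y = h a / h b)"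

lemma fract_extension:
  fixes h :: "'b::idom \<Rightarrow> 'c::field"
  assumes h: "h 1 = 1" "\<And>x y. h (x + y) = h x + h y" "\<And>x y. h (x * y) = h x * h y"
    "\<And>x. h x = 0 \<Longrightarrow> x = 0"
  shows fract_extension_Fract: "b \<noteq> 0 \<Longrightarrow> fract_extension h (Fract a b) = h a / h b"
    and fract_extension_1: "fract_extension h 1 = 1"
    and fract_extension_add: "fract_extension h (x + y) = fract_extension h x + fract_extension h y"
    and fract_extension_mult: "fract_extension h (x * y) = fract_extension h x * fract_extension h y"
proof -
  have F: "fract_extension h (Fract a b) = h a / h b" if b: "b \<noteq> 0" for a b
  proof -
    have "\<exists>a' b'. b' \<noteq> 0 \<and> Fract a b = Fract a' b' \<and> fract_extension h (Fract a b) = h a' / h b'"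
      unfolding fract_extension_def by (rule someI_ex) (use b in blast)
    then obtain a' b' where *: "b' \<noteq> 0" "Fract a b = Fract a' b'"
      "fract_extension h (Fract a b) = h a' / h b'" by blast
    then have "h a * h b' = h a' * h b" using b by (simp add: eq_fract flip: h(3))
    moreover have "h b \<noteq> 0" "h b' \<noteq> 0" using b * h(4) by auto
    ultimately show ?thesis unfolding *(3) by (simp add: frac_eq_eq)
  qed
  then show "b \<noteq> 0 \<Longrightarrow> fract_extension h (Fract a b) = h a / h b" .
  show "fract_extension h 1 = 1" using F[of 1 1] h(1) by (simp add: One_fract_def)
  obtain a b where x: "x = Fract a b" "b \<noteq> 0" by (cases x)
  obtain c d where y: "y = Fract c d" "d \<noteq> 0" by (cases y)
  have nz: "h b \<noteq> 0" "h d \<noteq> 0" using x y h(4) by auto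
  show "fract_extension h (x + y) = fract_extension h x + fract_extension h y"
    using x y nz by (simp add: F h add_frac_eq)
  show "fract_extension h (x * y) = fract_extension h x * fract_extension h y"
    using x y by (simp add: F h)
qed

text \<open>The expansion of a polynomial at infinity, in powers of the inverse of its variable.\<close>

definition fls_at_infinity :: "'c::field poly \<Rightarrow> 'c fls" where
  "fls_at_infinity p = poly (map_poly fls_const p) fls_X_inv"

lemma fls_at_infinity_0: "fls_at_infinity 0 = 0"
  and fls_at_infinity_pCons:
    "fls_at_infinity (pCons c p) = fls_const c + fls_X_inv * fls_at_infinity p"
  by (simp_all add: fls_at_infinity_def map_poly_pCons)

lemma fls_at_infinity_const: "fls_at_infinity [:c:] = fls_const c"
  by (simp add: fls_at_infinity_pCons fls_at_infinity_0)

lemma fls_at_infinity_add: "fls_at_infinity (p + q) = fls_at_infinity p + fls_at_infinity q"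
  by (induction p q rule: poly_induct2)
    (simp_all add: fls_at_infinity_0 fls_at_infinity_pCons algebra_simps flip: fls_plus_const)

lemma fls_at_infinity_smult: "fls_at_infinity (smult c p) = fls_const c * fls_at_infinity p"
  by (induction p)
    (simp_all add: fls_at_infinity_0 fls_at_infinity_pCons algebra_simps flip: fls_const_mult_const)

lemma fls_at_infinity_mult: "fls_at_infinity (p * q) = fls_at_infinity p * fls_at_infinity q"
  by (induction p)
    (simp_all add: fls_at_infinity_0 fls_at_infinity_pCons fls_at_infinity_add fls_at_infinity_smult
      algebra_simps)

lemma fls_at_infinity_leading:
  assumes "p \<noteq> 0"
  shows "fls_at_infinity p \<noteq> 0 \<and> fls_subdegree (fls_at_infinity p) = - int (degree p) \<and>
    fls_nth (fls_at_infinity p) (- int (degree p)) = lead_coeff p"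
  using assms
proof (induction p)
  case (pCons c p)
  show ?case
  proof (cases "p = 0")
    case True
    then show ?thesis using pCons.hyps by (simp add: fls_at_infinity_const)
  next
    case False
    let ?X = "fls_X_inv * fls_at_infinity p"
    let ?d = "- int (degree (pCons c p))"
    have IH: "fls_at_infinity p \<noteq> 0" "fls_subdegree (fls_at_infinity p) = - int (degree p)"
      "fls_nth (fls_at_infinity p) (- int (degree p)) = lead_coeff p" using pCons.IH False by auto
    have sX: "fls_subdegree ?X = ?d" using IH False by auto
    have n: "fls_nth (fls_at_infinity (pCons c p)) j = fls_nth ?X j" if "j < 0" for j
      using that by (simp add: fls_at_infinity_pCons)
    have lead: "fls_nth ?X ?d = lead_coeff p"
      using IH(3) False by (simp add: fls_X_inv_times_conv_shift)
    have "fls_subdegree (fls_at_infinity (pCons c p)) = ?d"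
      using False sX lead by (intro fls_subdegree_eqI) (auto simp: n)
    moreover have "fls_nth (fls_at_infinity (pCons c p)) ?d = lead_coeff (pCons c p)"
      using False lead n[of ?d] by simp
    moreover have "lead_coeff (pCons c p) \<noteq> 0" using pCons.hyps by auto
    ultimately show ?thesis by (metis fls_zero_nth)
  qed
qed simp

lemma to_fract_divide: "to_fract a / to_fract b = Fract a b"
  by (cases "b = 0") (simp_all add: to_fract_def fract_collapse)

lemma of_nat_to_fract: "of_nat n = to_fract (of_nat n :: 'b::idom)"
  by (induction n) auto

lemma to_fract_power: "to_fract (x ^ n) = to_fract x ^ n"
  by (induction n) auto

locale lnd =
  fixes D :: "'b::idom \<Rightarrow> 'b"
  assumes D: "D \<in> LND" and char_0: "\<And>n. n > 0 \<Longrightarrow> of_nat n \<noteq> (0 :: 'b)"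
begin

lemma D_add: "D (x + y) = D x + D y" and D_mult: "D (x * y) = D x * y + x * D y"
  and D_nilpotent: "\<exists>n. (D ^^ n) x = 0"
  using D by (auto simp: LND_def derivation_def)

lemma D_0: "D 0 = 0"
  using D_add[of 0 0] by (metis add_0_right add_cancel_right_right)

lemma D_1: "D 1 = 0"
  using D_mult[of 1 1] by (metis add_cancel_right_right mult_1 mult_1_right)

lemma D_uminus: "D (- x) = - D x"
  using D_add[of x "- x"] by (simp add: D_0 eq_neg_iff_add_eq_0 add.commute)

lemma Dn_0: "(D ^^ n) 0 = 0"
  by (induction n) (auto simp: D_0)

lemma Dn_add: "(D ^^ n) (x + y) = (D ^^ n) x + (D ^^ n) y"
  by (induction n) (auto simp: D_add)

lemma D_sum: "D (sum f I) = (\<Sum>i\<in>I. D (f i))"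
  by (induction I rule: infinite_finite_induct) (auto simp: D_0 D_add)

lemma D_of_nat_mult: "D (of_nat n * x) = of_nat n * D x"
  by (induction n) (auto simp: D_0 D_add distrib_right)

lemma Dn_mono: "(D ^^ n) x = 0 \<Longrightarrow> n \<le> i \<Longrightarrow> (D ^^ i) x = 0"
  by (metis Dn_0 funpow_add le_add_diff_inverse2 o_apply)

lemma leibniz: "(D ^^ n) (x * y) = (\<Sum>i\<le>n. of_nat (n choose i) * ((D ^^ i) x * (D ^^ (n - i)) y))"
proof (induction n)
  case (Suc n)
  let ?t = "\<lambda>i j. (D ^^ i) x * (D ^^ j) y"
  have "(D ^^ Suc n) (x * y) = (\<Sum>i\<le>n. of_nat (n choose i) * (?t (Suc i) (n - i) + ?t i (Suc (n - i))))"
    by (simp add: Suc D_sum D_of_nat_mult) (simp add: D_mult)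
  also have "\<dots> = (\<Sum>i\<le>n. of_nat (n choose i) * ?t (Suc i) (n - i)) +
      (\<Sum>i\<le>n. of_nat (n choose i) * ?t i (Suc n - i))"
    by (simp add: distrib_left sum.distrib Suc_diff_le)
  also have "(\<Sum>i\<le>n. of_nat (n choose i) * ?t i (Suc n - i)) =
      (\<Sum>i\<le>Suc n. of_nat (n choose i) * ?t i (Suc n - i))" by (simp add: binomial_eq_0)
  also have "\<dots> = ?t 0 (Suc n) + (\<Sum>i\<le>n. of_nat (n choose Suc i) * ?t (Suc i) (n - i))"
    by (subst sum.atMost_Suc_shift) simp
  also have "(\<Sum>i\<le>n. of_nat (n choose i) * ?t (Suc i) (n - i)) + (?t 0 (Suc n) +
      (\<Sum>i\<le>n. of_nat (n choose Suc i) * ?t (Suc i) (n - i))) =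
      (\<Sum>i\<le>Suc n. of_nat (Suc n choose i) * ?t i (Suc n - i))"
    by (subst sum.atMost_Suc_shift) (simp add: sum.distrib distrib_right)
  finally show ?case .
qed simp

lemma fact_nonzero: "of_nat (fact n) \<noteq> (0 :: 'b fract)"
  using char_0[of "fact n"] unfolding of_nat_to_fract by simp

text \<open>
  The exponential map of \<open>D\<close> with parameter \<open>T\<close>. Local nilpotency makes its values polynomials in
  \<open>T\<close>, and the Leibniz rule makes it a ring homomorphism. The degree in \<open>T\<close> is therefore additive
  on products.
\<close>

definition flow :: "'b \<Rightarrow> 'b fract poly" where
  "flow x = Abs_poly (\<lambda>n. to_fract ((D ^^ n) x) / of_nat (fact n))"

lemma coeff_flow: "coeff (flow x) n = to_fract ((D ^^ n) x) / of_nat (fact n)"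
proof -
  obtain N where "(D ^^ N) x = 0" using D_nilpotent by blast
  then show ?thesis unfolding flow_def using Dn_mono[of N x]
    by (subst coeff_Abs_poly[of N]) auto
qed

lemma flow_add: "flow (x + y) = flow x + flow y"
  by (rule poly_eqI) (simp add: coeff_flow Dn_add add_divide_distrib)

lemma flow_mult: "flow (x * y) = flow x * flow y"
proof (rule poly_eqI)
  fix n
  have sum: "to_fract (sum f I) = (\<Sum>i\<in>I. to_fract (f i))" for f :: "nat \<Rightarrow> 'b" and I
    by (induction I rule: infinite_finite_induct) auto
  have "of_nat (n choose i) / of_nat (fact n) = (1 :: 'b fract) / (of_nat (fact i) * of_nat (fact (n - i)))"
    if "i \<le> n" for i
  proof -
    have "of_nat (fact i * fact (n - i) * (n choose i)) = (of_nat (fact n) :: 'b fract)"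
      using binomial_fact_lemma[OF that] by simp
    then show ?thesis using fact_nonzero[of n] fact_nonzero[of i] fact_nonzero[of "n - i"]
      by (simp add: frac_eq_eq mult_ac)
  qed
  note b = this
  have "coeff (flow (x * y)) n =
      (\<Sum>i\<le>n. of_nat (n choose i) / of_nat (fact n) * (to_fract ((D ^^ i) x) * to_fract ((D ^^ (n - i)) y)))"
    by (simp add: of_nat_to_fract[symmetric] coeff_flow leibniz sum sum_divide_distrib)
  also have "\<dots> = (\<Sum>i\<le>n. coeff (flow x) i * coeff (flow y) (n - i))"
    by (intro sum.cong) (simp_all add: b coeff_flow)
  finally show "coeff (flow (x * y)) n = coeff (flow x * flow y) n" by (simp add: coeff_mult)
qed

lemma flow_ker: "x \<in> ker D \<Longrightarrow> flow x = [:to_fract x:]"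
proof (rule poly_eqI)
  fix n assume x: "x \<in> ker D"
  have "(D ^^ Suc n) x = 0" for n
    using Dn_mono[of 1 x "Suc n"] x by (simp add: ker_def)
  then show "coeff (flow x) n = coeff [:to_fract x:] n"
    by (cases n) (auto simp: coeff_flow coeff_pCons simp del: funpow.simps(2))
qed

lemma ker_0: "0 \<in> ker D" and ker_1: "1 \<in> ker D"
  and ker_add: "x \<in> ker D \<Longrightarrow> y \<in> ker D \<Longrightarrow> x + y \<in> ker D"
  and ker_mult: "x \<in> ker D \<Longrightarrow> y \<in> ker D \<Longrightarrow> x * y \<in> ker D"
  and ker_uminus: "x \<in> ker D \<Longrightarrow> - x \<in> ker D"
  by (auto simp: ker_def D_0 D_1 D_add D_mult D_uminus)

lemma ker_of_nat: "of_nat n \<in> ker D"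
  by (induction n) (auto intro: ker_0 ker_1 ker_add)

lemma ker_power: "x \<in> ker D \<Longrightarrow> x ^ n \<in> ker D"
  by (induction n) (auto intro: ker_1 ker_mult)

lemma flow_1: "flow 1 = 1"
  using flow_ker[OF ker_1] by simp

lemma flow_minus: "flow (x - y) = flow x - flow y"
  using flow_add[of "x - y" y] by simp

lemma flow_power: "flow (x ^ n) = flow x ^ n"
  by (induction n) (auto simp: flow_1 flow_mult)

lemma flow_eq_0_iff: "flow x = 0 \<longleftrightarrow> x = 0"
proof
  assume "flow x = 0"
  then show "x = 0" using coeff_flow[of x 0] by simp
qed (use flow_ker[OF ker_0] in simp)

lemma ker_iff_degree_flow: "x \<in> ker D \<longleftrightarrow> degree (flow x) = 0"
proof
  assume "degree (flow x) = 0"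
  then have "coeff (flow x) 1 = 0" by (simp add: coeff_eq_0)
  then show "x \<in> ker D" by (simp add: coeff_flow ker_def)
qed (simp add: flow_ker)

text \<open>The flow maps units of \<open>B\<close> to units of a polynomial ring, which are constant.\<close>

lemma unit_in_ker:
  assumes "u * v = 1" shows "u \<in> ker D"
proof -
  have "flow u * flow v = 1" using assms flow_1 by (metis flow_mult)
  moreover have "flow u \<noteq> 0" "flow v \<noteq> 0" using calculation by auto
  ultimately have "degree (flow u) = 0"
    using degree_mult_eq[of "flow u" "flow v"] by simp
  then show ?thesis by (simp add: ker_iff_degree_flow)
qed

lemma leading_derivative_in_ker: "(D ^^ degree (flow x)) x \<in> ker D"
proof -
  have "coeff (flow x) (Suc (degree (flow x))) = 0" by (simp add: coeff_eq_0)
  then have "(D ^^ Suc (degree (flow x))) x = 0"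
    using fact_nonzero[of "Suc (degree (flow x))"] unfolding coeff_flow by (simp del: funpow.simps fact_Suc)
  then show ?thesis by (simp add: ker_def)
qed

lemma Frac_ker_I: "a \<in> ker D \<Longrightarrow> b \<in> ker D \<Longrightarrow> to_fract a / to_fract b \<in> Frac (ker D)"
  unfolding to_fract_divide Frac_def using ker_0 ker_1
  by (cases "b = 0") (force simp: fract_collapse)+

lemma Frac_ker_E:
  assumes "x \<in> Frac (ker D)"
  obtains a b where "a \<in> ker D" "b \<in> ker D" "b \<noteq> 0" "x = to_fract a / to_fract b"
  using assms unfolding Frac_def to_fract_divide by blast

lemma to_fract_in_Frac_ker: "a \<in> ker D \<Longrightarrow> to_fract a \<in> Frac (ker D)"
  using Frac_ker_I[OF _ ker_1, of a] by simp

lemma is_subfield_Frac_ker: "is_subfield (Frac (ker D))"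
  unfolding is_subfield_def
proof (intro conjI ballI)
  show "0 \<in> Frac (ker D)" "1 \<in> Frac (ker D)"
    using to_fract_in_Frac_ker[OF ker_0] to_fract_in_Frac_ker[OF ker_1] by auto
  fix x assume "x \<in> Frac (ker D)"
  then obtain a b where x: "a \<in> ker D" "b \<in> ker D" "b \<noteq> 0" "x = to_fract a / to_fract b"
    by (rule Frac_ker_E)
  show "- x \<in> Frac (ker D)" using Frac_ker_I[OF ker_uminus[OF x(1)] x(2)] x(4) by simp
  show "inverse x \<in> Frac (ker D)" using Frac_ker_I[OF x(2,1)] x(4) by simp
  fix y assume "y \<in> Frac (ker D)"
  then obtain c d where y: "c \<in> ker D" "d \<in> ker D" "d \<noteq> 0" "y = to_fract c / to_fract d"
    by (rule Frac_ker_E)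
  have "x + y = to_fract (a * d + c * b) / to_fract (b * d)" "x * y = to_fract (a * c) / to_fract (b * d)"
    using x y by (simp_all add: add_frac_eq)
  moreover have "a * d + c * b \<in> ker D" "a * c \<in> ker D" "b * d \<in> ker D"
    using x y by (auto intro!: ker_add ker_mult)
  ultimately show "x + y \<in> Frac (ker D)" "x * y \<in> Frac (ker D)"
    using Frac_ker_I by metis+
qed

lemma Frac_ker_inter_ring: "to_fract b \<in> Frac (ker D) \<Longrightarrow> b \<in> ker D"
proof -
  assume "to_fract b \<in> Frac (ker D)"
  then obtain a c where *: "a \<in> ker D" "c \<in> ker D" "c \<noteq> 0" "to_fract b = to_fract a / to_fract c"
    by (rule Frac_ker_E)
  then have "to_fract (b * c) = to_fract a" by (simp add: field_simps)
  then have "b * c = a" by (simp only: to_fract_eq_iff)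
  then have "D b * c = 0" using * D_mult[of b c] by (auto simp: ker_def)
  then show ?thesis using * by (simp add: ker_def)
qed

text \<open>
  Expanding the flow at \<open>T = \<infinity>\<close> gives an embedding of \<open>Frac B\<close> into Laurent series, hence a
  discrete valuation. On \<open>B\<close> it is minus the degree of the flow, and its residue field is
  \<open>Frac (ker D)\<close>: a leading coefficient is the last nonzero derivative divided by a factorial.
\<close>

definition V :: "'b fract \<Rightarrow> 'b fract fls" where
  "V = fract_extension (\<lambda>x. fls_at_infinity (flow x))"

lemma V_hom:
  "fls_at_infinity (flow 1) = 1"
  "fls_at_infinity (flow (x + y)) = fls_at_infinity (flow x) + fls_at_infinity (flow y)"
  "fls_at_infinity (flow (x * y)) = fls_at_infinity (flow x) * fls_at_infinity (flow y)"
  "fls_at_infinity (flow x) = 0 \<Longrightarrow> x = 0"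
proof -
  show "fls_at_infinity (flow 1) = 1"
    using fls_at_infinity_const[of 1] by (simp add: flow_1 one_pCons)
qed (use fls_at_infinity_leading flow_eq_0_iff in
  \<open>auto simp: flow_add flow_mult fls_at_infinity_add fls_at_infinity_mult\<close>)

sublocale laurent_embedding V
  by unfold_locales
    (simp_all add: V_def fract_extension_1[OF V_hom] fract_extension_add[OF V_hom]
      fract_extension_mult[OF V_hom])

lemma V_to_fract: "V (to_fract x) = fls_at_infinity (flow x)"
  using fract_extension_Fract[OF V_hom, of 1 x] V_hom(1) by (simp add: V_def to_fract_def)

lemma ord_to_fract: "ord (to_fract x) = - int (degree (flow x))"
  using fls_at_infinity_leading[of "flow x"]
  by (cases "flow x = 0") (auto simp: ord_def V_to_fract fls_at_infinity_0)

lemma lc_to_fract: "lc (to_fract x) = lead_coeff (flow x)"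
  using fls_at_infinity_leading[of "flow x"] ord_to_fract[of x]
  by (cases "flow x = 0") (auto simp: lc_def V_to_fract fls_at_infinity_0)

lemma lc_in_Frac_ker: "lc x \<in> Frac (ker D)"
proof -
  have "lc (to_fract a) \<in> Frac (ker D)" for a
  proof -
    show ?thesis unfolding lc_to_fract coeff_flow unfolding of_nat_to_fract
      by (intro Frac_ker_I leading_derivative_in_ker ker_of_nat)
  qed
  moreover obtain a b where "x = to_fract a / to_fract b"
    unfolding to_fract_divide by (metis Fract_cases)
  ultimately show ?thesis using subfield_divide[OF is_subfield_Frac_ker] by (simp add: lc_divide)
qed

lemma V_Frac_ker:
  assumes "x \<in> Frac (ker D)" shows "V x = fls_const x"
proof -
  from assms obtain a b where *: "a \<in> ker D" "b \<in> ker D" "b \<noteq> 0" "x = to_fract a / to_fract b"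
    by (rule Frac_ker_E)
  have "V x * V (to_fract b) = V (to_fract a)" using * by (simp flip: V_mult)
  moreover have "fls_const (to_fract a) = fls_const x * fls_const (to_fract b)"
    using * by simp
  ultimately have "V x * fls_const (to_fract b) = fls_const x * fls_const (to_fract b)"
    using * by (simp only: V_to_fract flow_ker fls_at_infinity_const)
  moreover have "fls_const (to_fract b) \<noteq> 0" using *(3) by simp
  ultimately show ?thesis by (metis mult_right_cancel)
qed

lemma residues_UNIV: "residues UNIV = Frac (ker D)"
proof (rule subset_antisym)
  show "residues UNIV \<subseteq> Frac (ker D)"
    using lc_in_Frac_ker subfield_0[OF is_subfield_Frac_ker] by (auto simp: residues_def)
  show "Frac (ker D) \<subseteq> residues UNIV"
  proof
    fix x assume "x \<in> Frac (ker D)"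
    then have "V x = fls_const x" by (rule V_Frac_ker)
    then have "ord x = 0" "lc x = x" by (auto simp: ord_def lc_def)
    then show "x \<in> residues UNIV" using residuesI[of x UNIV] by simp
  qed
qed

end

locale nonzero_lnd = lnd D for D :: "'b::idom \<Rightarrow> 'b" +
  assumes D_nonzero: "D \<noteq> (\<lambda>x. 0)"
begin

text \<open>Among the iterated derivatives of an element outside the kernel, the last one outside it.\<close>

lemma local_slice: "\<exists>r. degree (flow r) = 1"
proof -
  obtain b where b: "D b \<noteq> 0" using D_nonzero by auto
  define n where "n = degree (flow b)"
  have n: "n > 0" using b ker_iff_degree_flow[of b] by (auto simp: ker_def n_def)
  define r where "r = (D ^^ (n - 1)) b"
  have "D r = (D ^^ n) b" using n by (cases n) (auto simp: r_def)
  moreover have "D ((D ^^ n) b) = 0" using leading_derivative_in_ker[of b] by (simp add: ker_def n_def)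
  moreover have "(D ^^ n) b \<noteq> 0"
  proof
    assume "(D ^^ n) b = 0"
    then have "lead_coeff (flow b) = 0" by (simp add: coeff_flow n_def)
    then show False using n by (simp add: n_def)
  qed
  ultimately have r: "D r \<noteq> 0" "D (D r) = 0" by auto
  have "(D ^^ i) r = 0" if "i > 1" for i
    using Dn_mono[of 2 r i] r that by (simp add: numeral_2_eq_2)
  then have "degree (flow r) \<le> 1" by (intro degree_le) (auto simp: coeff_flow)
  moreover have "degree (flow r) \<noteq> 0" using r ker_iff_degree_flow[of r] by (simp add: ker_def)
  ultimately show ?thesis by (intro exI[of _ r]) simp
qed

text \<open>
  A local slice, that is, an element outside the kernel with derivative in the kernel. It
  generates \<open>Frac B\<close> over \<open>Frac (ker D)\<close>.
\<close>

definition slice :: 'b where "slice = (SOME r. degree (flow r) = 1)"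

lemma slice: "degree (flow slice) = 1"
  unfolding slice_def by (rule someI_ex[OF local_slice])

text \<open>Subtracting a multiple of a power of the slice lowers the degree of the flow.\<close>

lemma ring_in_slice_polynomials:
  "\<exists>p\<in>polys_over (Frac (ker D)). to_fract b = poly p (to_fract slice)"
proof (induction "degree (flow b)" arbitrary: b rule: less_induct)
  case less
  note K = is_subfield_Frac_ker
  define n where "n = degree (flow b)"
  show ?case
  proof (cases "n = 0")
    case True
    then have "b \<in> ker D" by (simp add: ker_iff_degree_flow n_def)
    then show ?thesis
      by (intro bexI[of _ "[:to_fract b:]"] polys_over_const[OF K] to_fract_in_Frac_ker) auto
  next
    case False
    define c d u where "c = (D ^^ n) b" and "d = D slice" and "u = of_nat (fact n) * d ^ n"
    have c: "c \<in> ker D" using leading_derivative_in_ker[of b] by (simp add: c_def n_def)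
    have d: "d \<in> ker D" using leading_derivative_in_ker[of slice] by (simp add: slice d_def)
    have d0: "d \<noteq> 0" using slice ker_iff_degree_flow[of slice] by (auto simp: d_def ker_def)
    have u: "u \<in> ker D" unfolding u_def using d by (intro ker_mult ker_of_nat ker_power)
    have u0: "u \<noteq> 0" unfolding u_def using d0 char_0[of "fact n"] by simp
    define b' where "b' = u * b - c * slice ^ n"
    have fb': "flow b' = smult (to_fract u) (flow b) - smult (to_fract c) (flow slice ^ n)"
      by (simp add: b'_def flow_minus flow_mult flow_power flow_ker[OF u] flow_ker[OF c])
    have s1: "lead_coeff (flow slice) = to_fract d" unfolding slice by (simp add: coeff_flow d_def)
    have "flow slice \<noteq> 0" using slice by auto
    then have dp: "degree (flow slice ^ n) = n" using slice degree_power_eq[of "flow slice" n] by simp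
    have "coeff (flow slice ^ n) n = to_fract d ^ n"
      using lead_coeff_power[of "flow slice" n] dp s1 by simp
    then have "coeff (flow b') n = 0"
      using fact_nonzero[of n] by (simp add: fb' coeff_flow c_def[symmetric] u_def to_fract_power of_nat_to_fract)
    moreover have "degree (flow b') \<le> n" unfolding fb'
      using dp by (intro degree_diff_le order_trans[OF degree_smult_le]) (auto simp: n_def)
    ultimately have "degree (flow b') < n" using False
      by (metis coeff_0_degree_minus_1 eq_zero_or_degree_less gr0I degree_0)
    then obtain p where p: "p \<in> polys_over (Frac (ker D))" "to_fract b' = poly p (to_fract slice)"
      using less[of b'] n_def by blast
    have "to_fract u * to_fract b = to_fract b' + to_fract c * to_fract (slice ^ n)"
      by (simp add: b'_def flip: to_fract_add to_fract_mult)
    then have "to_fract b = poly (smult (inverse (to_fract u)) (p + monom (to_fract c) n)) (to_fract slice)"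
      using u0 by (simp add: p poly_monom to_fract_power field_simps)
    moreover have "smult (inverse (to_fract u)) (p + monom (to_fract c) n) \<in> polys_over (Frac (ker D))"
      using K p(1) u c by (intro polys_over_smult polys_over_add polys_over_monom subfield_inverse
        to_fract_in_Frac_ker)
    ultimately show ?thesis by blast
  qed
qed

lemma adjoin_slice: "adjoin (Frac (ker D)) {to_fract slice} = UNIV"
proof -
  let ?L = "adjoin (Frac (ker D)) {to_fract slice}"
  have L: "is_subfield ?L" by (rule is_subfield_adjoin)
  have s: "to_fract slice \<in> ?L" using adjoin_gen by fast
  have b: "to_fract b \<in> ?L" for b
    using ring_in_slice_polynomials[of b] poly_in_subfield[OF L _ s] polys_over_mono[OF adjoin_base] by force
  have "x \<in> ?L" for x
  proof -
    obtain a c where "x = to_fract a / to_fract c" unfolding to_fract_divide by (metis Fract_cases)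
    then show ?thesis using b subfield_divide[OF L] by blast
  qed
  then show ?thesis by blast
qed

text \<open>The valuation is trivial on \<open>Frac (ker D)\<close> but takes the value \<open>-1\<close> at the slice.\<close>

lemma slice_transcendental: "to_fract slice \<notin> alg_closure (Frac (ker D))"
proof (rule trivially_valued_transcendental[OF _ is_subfield_Frac_ker])
  show "trivially_valued (Frac (ker D))"
    by (auto simp: trivially_valued_def ord_def V_Frac_ker)
  show "ord (to_fract slice) \<noteq> 0" by (simp add: ord_to_fract slice)
qed

end

section \<open>Domains with two distinct kernels\<close>

text \<open>
  If \<open>b\<close> lay in the larger kernel only, its expression as a polynomial in a slice of \<open>D1\<close> would
  make that slice, and with it all of \<open>Frac B\<close>, algebraic over the field of fractions of the
  larger kernel.
\<close>

lemma ker_subset_imp_eq: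
  assumes "nonzero_lnd D1" "nonzero_lnd D2" and sub: "ker D1 \<subseteq> ker D2"
  shows "ker D1 = ker D2"
proof (rule ccontr)
  interpret D1: nonzero_lnd D1 by fact
  interpret D2: nonzero_lnd D2 by fact
  let ?K1 = "Frac (ker D1)" and ?K2 = "Frac (ker D2)"
  have sub': "?K1 \<subseteq> ?K2" using sub unfolding Frac_def by blast
  have A: "is_subfield (alg_closure ?K2)" "?K2 \<subseteq> alg_closure ?K2"
    using is_subfield_alg_closure alg_closure_base D2.is_subfield_Frac_ker by blast+
  assume "ker D1 \<noteq> ker D2"
  then obtain b where b: "b \<in> ker D2" "b \<notin> ker D1" using sub by blast
  obtain p where p: "p \<in> polys_over ?K1" "to_fract b = poly p (to_fract D1.slice)"
    using D1.ring_in_slice_polynomials by blast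
  have "p - [:to_fract b:] \<noteq> 0"
  proof
    assume "p - [:to_fract b:] = 0"
    then have "coeff p 0 = to_fract b" by simp
    then show False using p(1) b(2) D1.Frac_ker_inter_ring unfolding polys_over_def by (metis mem_Collect_eq)
  qed
  moreover have "p - [:to_fract b:] \<in> polys_over ?K2"
    using polys_over_mono[OF sub'] p(1) D2.to_fract_in_Frac_ker[OF b(1)]
    by (intro polys_over_diff polys_over_const D2.is_subfield_Frac_ker) auto
  moreover have "poly (p - [:to_fract b:]) (to_fract D1.slice) = 0" using p(2) by simp
  ultimately have "to_fract D1.slice \<in> alg_closure ?K2" unfolding alg_closure_def by blast
  then have "adjoin ?K1 {to_fract D1.slice} \<subseteq> alg_closure ?K2"
    using sub' A by (intro adjoin_least) auto
  then show False using D2.slice_transcendental unfolding D1.adjoin_slice by blast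
qed

text \<open>
  The ruled residue theorem for the valuation of \<open>D2\<close> on \<open>Frac B\<close>, viewed as a simple extension of
  \<open>Frac (ker D1)\<close>. An element \<open>a\<close> that \<open>D1\<close> kills and \<open>D2\<close> does not shows that the valuation is
  nontrivial there, and counting transcendence degrees excludes the algebraic alternative.
\<close>

lemma Frac_ker_simple_transcendental:
  assumes D: "nonzero_lnd D1" "nonzero_lnd D2" and ne: "ker D1 \<noteq> ker D2"
    and k: "is_subfield k" "k \<subseteq> Frac (ker D1)" "k \<subseteq> Frac (ker D2)" and fin: "trdeg k UNIV < \<infinity>"
  shows "\<exists>F y. is_subfield F \<and> k \<subseteq> F \<and> y \<notin> alg_closure F \<and> Frac (ker D2) = adjoin F {y}"
proof -
  interpret D1: nonzero_lnd D1 by fact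
  interpret D2: nonzero_lnd D2 by fact
  let ?K = "Frac (ker D1)" and ?s = "to_fract D1.slice"
  obtain a where a: "a \<in> ker D1" "a \<notin> ker D2" using ker_subset_imp_eq[OF D] ne by blast
  let ?a = "inverse (to_fract a)"
  have a_ord: "D2.ord ?a > 0"
    using a(2) by (simp add: D2.ord_inverse D2.ord_to_fract D2.ker_iff_degree_flow)
  have aK: "?a \<in> ?K"
    using subfield_inverse[OF D1.is_subfield_Frac_ker] D1.to_fract_in_Frac_ker[OF a(1)] by blast
  interpret valued_simple_extension D2.V ?K ?a ?s
    by unfold_locales (use D1.is_subfield_Frac_ker aK a_ord in auto)
  have Vk: "D2.V c = fls_const c" if "c \<in> k" for c using that k(3) D2.V_Frac_ker by blast
  have "\<not> Frac (ker D2) \<subseteq> alg_closure (D2.residues ?K)"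
    using a_ord aK k fin Vk
    by (intro residue_extension_not_algebraic[of D2.V k ?K ?a ?s "Frac (ker D2)" "to_fract D2.slice"]
        D2.laurent_embedding_axioms D1.is_subfield_Frac_ker D1.slice_transcendental D2.adjoin_slice) auto
  then obtain F y where F: "is_subfield F" "D2.residues ?K \<subseteq> F" "y \<notin> alg_closure F"
    "Frac (ker D2) = adjoin F {y}"
    using ruled_residue_field unfolding D1.adjoin_slice D2.residues_UNIV by blast
  have "k \<subseteq> D2.residues ?K"
  proof
    fix c assume "c \<in> k"
    then have "D2.ord c = 0" "D2.lc c = c" using Vk by (simp_all add: D2.ord_def D2.lc_def)
    then show "c \<in> D2.residues ?K" using D2.residuesI[of c ?K] \<open>c \<in> k\<close> k(2) by auto
  qed
  then show ?thesis using F by blast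
qed

lemma algebra_map_0:
  assumes "algebra_map \<iota>" shows "\<iota> 0 = 0"
proof -
  have "\<iota> (0 + 0) = \<iota> 0 + \<iota> 0" using assms unfolding algebra_map_def by blast
  then show ?thesis by (metis add_0_right add_cancel_right_right)
qed

lemma algebra_map_of_nat: "algebra_map \<iota> \<Longrightarrow> \<iota> (of_nat n) = of_nat n"
  by (induction n) (auto simp: algebra_map_0, auto simp: algebra_map_def)

lemma algebra_map_inverse: "algebra_map \<iota> \<Longrightarrow> c \<noteq> 0 \<Longrightarrow> \<iota> c * \<iota> (inverse c) = 1"
  unfolding algebra_map_def by (metis right_inverse)

lemma algebra_map_uminus: "algebra_map \<iota> \<Longrightarrow> \<iota> (- c) = - \<iota> c"
  using algebra_map_0 unfolding algebra_map_def by (metis add_eq_0_iff)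

lemma is_subfield_ground_field:
  fixes \<iota> :: "'k::field \<Rightarrow> 'b::idom"
  assumes "algebra_map \<iota>"
  shows "is_subfield (ground_field \<iota>)"
  unfolding is_subfield_def
proof (intro conjI ballI)
  have G: "to_fract (\<iota> c) \<in> ground_field \<iota>" for c by (auto simp: ground_field_def)
  have hom: "\<iota> (c + d) = \<iota> c + \<iota> d" "\<iota> (c * d) = \<iota> c * \<iota> d" "\<iota> 1 = 1" for c d
    using assms by (auto simp: algebra_map_def)
  show "0 \<in> ground_field \<iota>" "1 \<in> ground_field \<iota>"
    using G[of 0] G[of 1] hom algebra_map_0[OF assms] by auto
  fix x assume "x \<in> ground_field \<iota>"
  then obtain c where c: "x = to_fract (\<iota> c)" by (auto simp: ground_field_def)
  show "- x \<in> ground_field \<iota>" using G[of "- c"] c algebra_map_uminus[OF assms] by simp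
  show "inverse x \<in> ground_field \<iota>"
  proof (cases "c = 0")
    case False
    have "x * to_fract (\<iota> (inverse c)) = 1"
      unfolding c using algebra_map_inverse[OF assms False] by (metis to_fract_1 to_fract_mult)
    then have "inverse x = to_fract (\<iota> (inverse c))" by (rule inverse_unique)
    then show ?thesis using G by simp
  qed (use c G[of 0] algebra_map_0[OF assms] in auto)
  fix y assume "y \<in> ground_field \<iota>"
  then obtain d where d: "y = to_fract (\<iota> d)" by (auto simp: ground_field_def)
  show "x + y \<in> ground_field \<iota>" "x * y \<in> ground_field \<iota>"
    using G[of "c + d"] G[of "c * d"] c d hom by auto
qed

lemma Frac_UNIV: "Frac (UNIV :: 'b::idom set) = UNIV"
proof -
  have "x \<in> Frac UNIV" for x :: "'b fract"
    by (cases x) (auto simp: Frac_def)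
  then show ?thesis by blast
qed

theorem corollary2p3:
  fixes \<iota> :: "'k::field_char_0 \<Rightarrow> 'b::idom"
  assumes "algebra_map \<iota>"
    and "trdeg (ground_field \<iota>) (Frac (UNIV :: 'b set)) < \<infinity>"
    and "\<not> semi_rigid TYPE('b)"
  shows "(\<forall>D \<in> (LND :: ('b \<Rightarrow> 'b) set). ruled (ground_field \<iota>) (Frac (ker D))) \<and>
    (\<exists>K. is_subfield K \<and> ground_field \<iota> \<subseteq> K \<and> K \<subseteq> Frac (UNIV :: 'b set) \<and>
         purely_transcendental K (Frac (UNIV :: 'b set)) 2)"
proof -
  let ?k = "ground_field \<iota>"
  have char_0: "of_nat n \<noteq> (0 :: 'b)" if "n > 0" for n
    using algebra_map_inverse[OF assms(1), of "of_nat n"] algebra_map_of_nat[OF assms(1), of n] that by auto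
  have lnd: "nonzero_lnd D" if "D \<in> LND" "D \<noteq> (\<lambda>x. 0)" for D :: "'b \<Rightarrow> 'b"
    using that char_0 by unfold_locales auto
  have kD: "?k \<subseteq> Frac (ker D)" if "nonzero_lnd D" for D :: "'b \<Rightarrow> 'b"
  proof -
    interpret nonzero_lnd D by fact
    have "\<iota> c \<in> ker D" for c
      using algebra_map_0[OF assms(1)] algebra_map_inverse[OF assms(1)] ker_0 unit_in_ker
      by (cases "c = 0") auto
    then show ?thesis using to_fract_in_Frac_ker by (auto simp: ground_field_def)
  qed
  have fin: "trdeg ?k (UNIV :: 'b fract set) < \<infinity>" using assms(2) by (simp add: Frac_UNIV)
  obtain D1 D2 :: "'b \<Rightarrow> 'b" where D: "nonzero_lnd D1" "nonzero_lnd D2" "ker D1 \<noteq> ker D2"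
    using assms(3) lnd unfolding semi_rigid_def by blast
  have simple: "\<exists>F y. is_subfield F \<and> ?k \<subseteq> F \<and> y \<notin> alg_closure F \<and> Frac (ker D) = adjoin F {y}"
    if "nonzero_lnd D" for D :: "'b \<Rightarrow> 'b"
  proof -
    obtain D' :: "'b \<Rightarrow> 'b" where D': "nonzero_lnd D'" "ker D' \<noteq> ker D" using D by metis
    then show ?thesis
      using Frac_ker_simple_transcendental[OF D'(1) that D'(2) is_subfield_ground_field[OF assms(1)]]
        kD[OF that] kD[OF D'(1)] fin by blast
  qed
  have ruledI: "ruled ?k (adjoin F {y})" if "is_subfield F" "?k \<subseteq> F" "y \<notin> alg_closure F" for F y
    unfolding ruled_def using that purely_transcendental_1I[OF that(1,3)] adjoin_base by blast
  interpret D2: nonzero_lnd D2 by (rule D(2))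
  have "ruled ?k (Frac (ker D))" if DL: "D \<in> LND" for D :: "'b \<Rightarrow> 'b"
  proof (cases "D = (\<lambda>x. 0)")
    case True
    \<comment> \<open>Here the kernel is \<open>B\<close>, and \<open>Frac B\<close> is generated by a slice of another derivation.\<close>
    then have "Frac (ker D) = adjoin (Frac (ker D2)) {to_fract D2.slice}"
      unfolding D2.adjoin_slice by (simp add: ker_def Frac_UNIV)
    then show ?thesis
      using ruledI[OF D2.is_subfield_Frac_ker kD[OF D(2)] D2.slice_transcendental] by simp
  next
    case False
    then show ?thesis using simple[OF lnd[OF DL False]] ruledI by metis
  qed
  moreover obtain F y where F: "is_subfield F" "?k \<subseteq> F" "y \<notin> alg_closure F" "Frac (ker D2) = adjoin F {y}"
    using simple[OF D(2)] by blast
  have "purely_transcendental F (Frac (UNIV :: 'b set)) 2"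
    using purely_transcendental_2I[OF F(1,3), of "to_fract D2.slice"]
      D2.slice_transcendental D2.adjoin_slice by (simp add: F(4) Frac_UNIV)
  ultimately show ?thesis using F by (auto simp: Frac_UNIV)
qed

end
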